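(* Let $d\ge2$. For every integer $n\ge0$, every $u\in\mathcal V_n^E(\mathbb V_0^{d+1},e^{-t^2})$ satisfies $$\Big[\partial_t^2-2t\,\partial_t+\frac{d-1}t\partial_t+\frac1{t^2}\Delta_0^{(x)}\Big]u=-2n\,u;$$ moreover, every $u\in\mathcal V_n^O(\mathbb V_0^{d+1},|t|^{-2}e^{-t^2})$ satisfies $$\Big[\partial_t^2-2t\,\partial_t+\frac{d-3}t\Big(\partial_t-\frac1t\Big)+\frac1{t^2}\Delta_0^{(x)}\Big]u=-2n\,u .$$
   Context: $\mathbb V_0^{d+1}=\{(x,t)\in\mathbb R^d\times\mathbb R:\ \|x\|=|t|\}$ is the infinite double cone. Integration over it means $\int f\,d\sigma=\int_{-\infty}^\infty|t|^{d-1}\int_{\mathbb S^{d-1}}f(|t|\xi,t)\,d\sigma(\xi)\,dt$. For an even weight $w$, $\langle f,g\rangle_w=\int_{\mathbb V_0^{d+1}}f\,g\,w(t)\,d\sigma(x,t)$. $\mathcal V_n^E(\mathbb V_0^{d+1},w)$ (resp. $\mathcal V_n^O(\mathbb V_0^{d+1},w)$) is the space of restrictions to $\mathbb V_0^{d+1}$ of polynomials in $(x,t)$ of degree at most $n$ that are even (resp. odd) in $t$, i.e. $u(x,-t)=\pm u(x,t)$ on $\mathbb V_0^{d+1}$, and orthogonal with respect to $\langle\cdot,\cdot\rangle_w$ to all polynomials of degree at most $n-1$ that are even (resp. odd) in $t$. (For $w=|t|^{-2}e^{-t^2}$ the form is used only on functions odd in $t$, where it is finite.) The operators are understood in the coordinates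 $(\xi,t)$, $x=|t|\xi$, $\xi\in\mathbb S^{d-1}$, $t\neq0$: $\partial_t$ is the derivative in $t$ with $\xi$ fixed, and $\Delta_0^{(x)}$ is the Laplace–Beltrami operator of $\mathbb S^{d-1}$ acting on $\xi$. *)

theory Defs
  imports "HOL-Analysis.Analysis"
begin

definition double_cone :: "((real ^ 'd) \<times> real) set" where
  "double_cone = {(x, t). norm x = \<bar>t\<bar>}"

(* Surface measure of the unit sphere as cone measure:
   sigma(A) = d * vol {r xi | 0 < r < 1, xi in A}; the total mass is d * vol(ball). *)
definition sphere_measure :: "(real ^ 'd) measure" where
  "sphere_measure =
     scale_measure (of_nat CARD('d))
       (distr (restrict_space lborel (ball 0 1 - {0})) (restrict_space borel (sphere 0 1))
          (\<lambda>y. y /\<^sub>R norm y))"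

definition cone_integral :: "((real ^ 'd) \<times> real \<Rightarrow> real) \<Rightarrow> real" where
  "cone_integral f =
     (LINT t|lborel. \<bar>t\<bar> ^ (CARD('d) - 1) * (LINT \<xi>|sphere_measure. f (\<bar>t\<bar> *\<^sub>R \<xi>, t)))"

definition cone_inner ::
  "(real \<Rightarrow> real) \<Rightarrow> ((real ^ 'd) \<times> real \<Rightarrow> real) \<Rightarrow> ((real ^ 'd) \<times> real \<Rightarrow> real) \<Rightarrow> real" where
  "cone_inner w f g = cone_integral (\<lambda>(x, t). f (x, t) * g (x, t) * w t)"

definition exponents_le :: "nat \<Rightarrow> (('d::finite \<Rightarrow> nat) \<times> nat) set" where
  "exponents_le n = {(\<alpha>, k). (\<Sum>i\<in>UNIV. \<alpha> i) + k \<le> n}"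

lemma finite_exponents_le: "finite (exponents_le n :: (('d::finite \<Rightarrow> nat) \<times> nat) set)"
proof (rule finite_subset)
  have "\<alpha> i \<le> (\<Sum>i\<in>UNIV. \<alpha> i)" for \<alpha> :: "'d \<Rightarrow> nat" and i
    by (rule member_le_sum) auto
  then show "exponents_le n \<subseteq> (UNIV \<rightarrow>\<^sub>E {..n} :: ('d \<Rightarrow> nat) set) \<times> {..n}"
    by (fastforce simp: exponents_le_def PiE_def intro: order_trans)
  show "finite ((UNIV \<rightarrow>\<^sub>E {..n} :: ('d \<Rightarrow> nat) set) \<times> {..n})"
    by (intro finite_cartesian_product finite_PiE) auto
qed

definition poly_fun_le :: "nat \<Rightarrow> ((real ^ 'd) \<times> real \<Rightarrow> real) \<Rightarrow> bool" where
  "poly_fun_le n p \<longleftrightarrow>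
     (\<exists>c. \<forall>x t. p (x, t) =
        (\<Sum>(\<alpha>, k)\<in>exponents_le n. c \<alpha> k * ((\<Prod>i\<in>UNIV. (x $ i) ^ \<alpha> i) * t ^ k)))"

definition cone_even :: "((real ^ 'd) \<times> real \<Rightarrow> real) \<Rightarrow> bool" where
  "cone_even f \<longleftrightarrow> (\<forall>(x, t)\<in>double_cone. f (x, - t) = f (x, t))"

definition cone_odd :: "((real ^ 'd) \<times> real \<Rightarrow> real) \<Rightarrow> bool" where
  "cone_odd f \<longleftrightarrow> (\<forall>(x, t)\<in>double_cone. f (x, - t) = - f (x, t))"

(* "Degree at most n - 1" is rendered as "degree at most m for some m < n": for n = 0 the only
   such polynomial is 0 and there is no orthogonality condition. *)
definition cone_orth_space ::
  "(((real ^ 'd) \<times> real \<Rightarrow> real) \<Rightarrow> bool) \<Rightarrow> nat \<Rightarrow> (real \<Rightarrow> real) \<Rightarrow> ((real ^ 'd) \<times> real \<Rightarrow> real) set" where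
  "cone_orth_space P n w =
     {u. (\<exists>p. poly_fun_le n p \<and> u = restrict p double_cone) \<and> P u \<and>
         (\<forall>m q. m < n \<and> poly_fun_le m q \<and> P q \<longrightarrow> cone_inner w u q = 0)}"

definition cone_VE :: "nat \<Rightarrow> (real \<Rightarrow> real) \<Rightarrow> ((real ^ 'd) \<times> real \<Rightarrow> real) set" where
  "cone_VE = cone_orth_space cone_even"

definition cone_VO :: "nat \<Rightarrow> (real \<Rightarrow> real) \<Rightarrow> ((real ^ 'd) \<times> real \<Rightarrow> real) set" where
  "cone_VO = cone_orth_space cone_odd"

definition laplacian :: "(real ^ 'd \<Rightarrow> real) \<Rightarrow> real ^ 'd \<Rightarrow> real" where
  "laplacian F x = (\<Sum>i\<in>UNIV. deriv (deriv (\<lambda>s. F (x + s *\<^sub>R axis i 1))) 0)"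

(* Laplace-Beltrami operator of the unit sphere: the Euclidean Laplacian of the extension that is
   constant along rays, evaluated on the sphere.  Only the values of f on the sphere matter. *)
definition laplace_beltrami :: "(real ^ 'd \<Rightarrow> real) \<Rightarrow> real ^ 'd \<Rightarrow> real" where
  "laplace_beltrami f \<xi> = laplacian (\<lambda>y. f (y /\<^sub>R norm y)) \<xi>"

definition cone_coords :: "((real ^ 'd) \<times> real \<Rightarrow> real) \<Rightarrow> real ^ 'd \<Rightarrow> real \<Rightarrow> real" where
  "cone_coords u \<xi> t = u (\<bar>t\<bar> *\<^sub>R \<xi>, t)"

definition partial_t :: "(real ^ 'd \<Rightarrow> real \<Rightarrow> real) \<Rightarrow> real ^ 'd \<Rightarrow> real \<Rightarrow> real" where
  "partial_t U \<xi> t = deriv (U \<xi>) t"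

definition sphere_laplacian :: "(real ^ 'd \<Rightarrow> real \<Rightarrow> real) \<Rightarrow> real ^ 'd \<Rightarrow> real \<Rightarrow> real" where
  "sphere_laplacian U \<xi> t = laplace_beltrami (\<lambda>\<eta>. U \<eta> t) \<xi>"

(* In the two operators, U is a function of the coordinates (xi, t), d is CARD('d), t is nonzero. *)
definition cone_op_even :: "(real ^ 'd \<Rightarrow> real \<Rightarrow> real) \<Rightarrow> real ^ 'd \<Rightarrow> real \<Rightarrow> real" where
  "cone_op_even U \<xi> t =
     partial_t (partial_t U) \<xi> t - 2 * t * partial_t U \<xi> t
     + (real CARD('d) - 1) / t * partial_t U \<xi> t
     + 1 / t\<^sup>2 * sphere_laplacian U \<xi> t"

definition cone_op_odd :: "(real ^ 'd \<Rightarrow> real \<Rightarrow> real) \<Rightarrow> real ^ 'd \<Rightarrow> real \<Rightarrow> real" where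
  "cone_op_odd U \<xi> t =
     partial_t (partial_t U) \<xi> t - 2 * t * partial_t U \<xi> t
     + (real CARD('d) - 3) / t * (partial_t U \<xi> t - 1 / t * U \<xi> t)
     + 1 / t\<^sup>2 * sphere_laplacian U \<xi> t"

end

theory Submission
  imports Defs "HOL-Probability.Distributions"
begin

text \<open>
  On the double cone the square of \<open>t\<close> equals the square of the norm of \<open>x\<close>. Hence a polynomial that
  is even in \<open>t\<close> restricts to \<open>F x\<close> for a polynomial \<open>F\<close> of the same degree, and an odd one to
  \<open>t * F x\<close> with the degree of \<open>F\<close> lowered by one. In polar coordinates both inner products become
  twice the Gaussian inner product of the factors \<open>F\<close> on Euclidean space, so \<open>F\<close> is orthogonal to
  all polynomials of lower degree there. The operator \<open>L = \<Delta> - 2 x \<bullet> \<nabla>\<close> is symmetric for this inner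
  product and acts on the part of top degree \<open>n\<close>, modulo lower degree, as
  multiplication by \<open>- 2 n\<close>. So \<open>L F + 2 n F\<close> has
  lower degree and is orthogonal to itself, i.e. it vanishes. In the coordinates \<open>(\<xi>, t)\<close> the even
  operator is \<open>L\<close>, and the odd operator maps \<open>t F\<close> to \<open>t (L F - 2 F)\<close>.
\<close>

subsection \<open>Polar coordinates\<close>

lemma sets_sphere_measure [measurable_cong]:
  "sets (sphere_measure :: (real ^ 'd) measure) = sets (restrict_space borel (sphere 0 1))"
  by (simp add: sphere_measure_def)

lemma space_sphere_measure: "space (sphere_measure :: (real ^ 'd) measure) = sphere 0 1"
  using sets_eq_imp_space_eq[OF sets_sphere_measure[where 'd = 'd]] by (simp add: space_restrict_space)

lemma measurable_radial_projection:
  assumes "0 \<notin> A"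
  shows "(\<lambda>y::real ^ 'd. y /\<^sub>R norm y)
    \<in> restrict_space borel A \<rightarrow>\<^sub>M restrict_space borel (sphere 0 1)"
proof (rule measurable_restrict_space2)
  show "(\<lambda>y. y /\<^sub>R norm y) \<in> space (restrict_space borel A) \<rightarrow> (sphere 0 1 :: (real ^ 'd) set)"
    using assms by (auto simp: space_restrict_space) (metis left_inverse norm_eq_zero)
  show "(\<lambda>y. y /\<^sub>R norm y) \<in> restrict_space borel A \<rightarrow>\<^sub>M (borel :: (real ^ 'd) measure)"
    by (rule measurable_restrict_space1) measurable
qed

text \<open>The infinite cone over \<open>B\<close> without its apex. Cut off by the unit ball it is
  the sector whose volume defines \<open>sphere_measure\<close>.\<close>

definition radial_cone :: "(real ^ 'd) set \<Rightarrow> (real ^ 'd) set" where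
  "radial_cone B = {y. y \<noteq> 0 \<and> y /\<^sub>R norm y \<in> B}"

lemma borel_radial_cone:
  assumes "B \<in> sets (restrict_space borel (sphere 0 1))"
  shows "radial_cone B \<in> sets (borel :: (real ^ 'd) measure)"
proof -
  have "(\<lambda>y. y /\<^sub>R norm y) -` B \<inter> space (restrict_space borel (- {0 :: real ^ 'd}))
      \<in> sets (restrict_space borel (- {0}))"
    using measurable_radial_projection assms by (rule measurable_sets) simp
  moreover have "(\<lambda>y. y /\<^sub>R norm y) -` B \<inter> space (restrict_space borel (- {0 :: real ^ 'd})) = radial_cone B"
    by (auto simp: radial_cone_def space_restrict_space)
  ultimately show ?thesis
    by (subst (asm) sets_restrict_space_iff) auto
qed

lemma emeasure_sphere_measure:
  assumes B: "B \<in> sets (restrict_space borel (sphere 0 1))"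
  shows "emeasure (sphere_measure :: (real ^ 'd) measure) B
    = of_nat CARD('d) * emeasure lborel (radial_cone B \<inter> ball 0 1)"
proof -
  let ?M = "restrict_space lborel (ball 0 1 - {0}) :: (real ^ 'd) measure"
  have m: "(\<lambda>y. y /\<^sub>R norm y) \<in> ?M \<rightarrow>\<^sub>M restrict_space borel (sphere 0 1)"
    using measurable_radial_projection[of "ball 0 1 - {0 :: real ^ 'd}"]
    by (simp cong: measurable_cong_sets sets_restrict_space_cong)
  have "emeasure sphere_measure B = of_nat CARD('d) * emeasure ?M ((\<lambda>y. y /\<^sub>R norm y) -` B \<inter> space ?M)"
    by (simp add: sphere_measure_def emeasure_scale_measure emeasure_distr[OF m B])
  also have "(\<lambda>y. y /\<^sub>R norm y) -` B \<inter> space ?M = radial_cone B \<inter> ball 0 1"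
    by (auto simp: radial_cone_def space_restrict_space)
  also have "emeasure ?M (radial_cone B \<inter> ball 0 1) = emeasure lborel (radial_cone B \<inter> ball 0 1)"
    by (rule emeasure_restrict_space) (auto simp: radial_cone_def)
  finally show ?thesis .
qed

text \<open>Dilation by \<open>r\<close> maps the sector of radius 1 onto the sector of radius
  \<open>r\<close> and multiplies volume by \<open>r ^ CARD('d)\<close>.\<close>

lemma emeasure_radial_cone_ball:
  assumes B: "B \<in> sets (restrict_space borel (sphere 0 1))" and r: "0 < r"
  shows "emeasure lborel (radial_cone B \<inter> ball (0 :: real ^ 'd) r)
    = ennreal (r ^ CARD('d)) * emeasure lborel (radial_cone B \<inter> ball 0 1)"
proof -
  let ?A = "radial_cone B \<inter> ball (0 :: real ^ 'd) r"
  have A: "?A \<in> sets borel"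
    using borel_radial_cone[OF B] by auto
  have "emeasure lborel ?A
      = emeasure (density (distr lborel borel (\<lambda>x. 0 + r *\<^sub>R x)) (\<lambda>_. ennreal (\<bar>r\<bar> ^ DIM(real ^ 'd)))) ?A"
    using r by (subst lborel_affine[of r 0, symmetric]) auto
  also have "\<dots> = ennreal (r ^ CARD('d)) * emeasure lborel ((\<lambda>x. r *\<^sub>R x) -` ?A)"
    using A r by (simp add: emeasure_density nn_integral_cmult emeasure_distr)
  also have "(\<lambda>x. r *\<^sub>R x) -` ?A = radial_cone B \<inter> ball 0 1"
    using r by (auto simp: radial_cone_def field_simps)
  finally show ?thesis .
qed

text \<open>The radial factor of Lebesgue measure in polar coordinates, extended by zero to the
  whole line.\<close>

definition radial_measure :: "nat \<Rightarrow> real measure" where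
  "radial_measure d = density lborel (\<lambda>r. ennreal (indicator {0<..} r * r ^ (d - 1)))"

lemma sets_radial_measure [simp, measurable_cong]: "sets (radial_measure d) = sets borel"
  by (simp add: radial_measure_def)

lemma emeasure_radial_measure_lessThan:
  assumes "0 < d"
  shows "of_nat d * emeasure (radial_measure d) {..<r} = ennreal (max 0 r ^ d)"
proof -
  have "emeasure (radial_measure d) {..<r}
      = (\<integral>\<^sup>+ s. ennreal (indicator {0<..} s * s ^ (d - 1)) * indicator {..<r} s \<partial>lborel)"
    by (simp add: radial_measure_def emeasure_density)
  \<comment> \<open>The two integrands differ at most at the endpoints \<open>0\<close> and
    \<open>r\<close>; \<open>max 0 r\<close> also covers nonpositive \<open>r\<close>, where both
    integrals vanish.\<close>
  also have "\<dots> = (\<integral>\<^sup>+ s. ennreal (s ^ (d - 1)) * indicator {0..max 0 r} s \<partial>lborel)"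
    using AE_lborel_singleton[of 0] AE_lborel_singleton[of r]
    by (intro nn_integral_cong_AE) (auto elim!: eventually_elim2 split: split_indicator)
  also have "\<dots> = ennreal (max 0 r ^ d / d - 0 ^ d / d)"
    by (rule nn_integral_FTC_Icc) (use assms in \<open>auto intro!: derivative_eq_intros\<close>)
  finally show ?thesis
    using assms by (simp add: ennreal_of_nat_eq_real_of_nat ennreal_mult[symmetric] zero_power)
qed

text \<open>Both measures agree on the half-lines \<open>{..<r}\<close> by homogeneity of the volume
  of sectors, and these form an intersection-stable generator of the Borel sets. The factor
  \<open>CARD('d)\<close> in \<open>sphere_measure\<close> cancels the \<open>1 / d\<close> from
  integrating \<open>r ^ (d - 1)\<close>.\<close>

lemma distr_norm_radial_cone:
  assumes B: "B \<in> sets (restrict_space borel (sphere 0 1 :: (real ^ 'd) set))"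
  shows "scale_measure (emeasure sphere_measure B) (radial_measure CARD('d))
    = distr (restrict_space lborel (radial_cone B)) borel norm" (is "?M = ?N")
proof -
  have [measurable]: "norm \<in> restrict_space lborel (radial_cone B) \<rightarrow>\<^sub>M borel"
    by (rule measurable_restrict_space1) simp
  have eq: "emeasure ?M {..<r} = emeasure ?N {..<r}" for r :: real
  proof (cases "0 < r")
    case True
    have "emeasure ?N {..<r} = emeasure lborel (radial_cone B \<inter> ball 0 r)"
      using borel_radial_cone[OF B]
      by (subst emeasure_distr) (auto simp: emeasure_restrict_space space_restrict_space
          intro!: arg_cong[where f = "emeasure lborel"])
    also have "\<dots> = emeasure ?M {..<r}"
      using True emeasure_radial_measure_lessThan[OF zero_less_card_finite[where 'a = 'd], of r]
      by (simp add: emeasure_radial_cone_ball[OF B True] emeasure_sphere_measure[OF B] ac_simps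
          flip: mult.assoc)
    finally show ?thesis by simp
  next
    case False
    then have "norm -` {..<r} \<inter> space (restrict_space lborel (radial_cone B)) = {}"
      by (auto simp: not_less dest: less_le_trans)
    then show ?thesis
      using False emeasure_radial_measure_lessThan[OF zero_less_card_finite[where 'a = 'd], of r]
      by (simp add: emeasure_distr max_absorb1 zero_power)
  qed
  show ?thesis
  proof (rule measure_eqI_generator_eq)
    show "Int_stable (range lessThan :: real set set)"
      by (auto simp: Int_stable_def intro: range_eqI[of _ _ "min _ _"])
    show "emeasure ?M X = emeasure ?N X" if "X \<in> range lessThan" for X
      using that eq by auto
    show "sets ?M = sigma_sets UNIV (range lessThan)" "sets ?N = sigma_sets UNIV (range lessThan)"
      by (simp_all add: borel_eq_lessThan eucl_less_def lessThan_def)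
    show "range (\<lambda>n. {..<real n}) \<subseteq> range lessThan"
      by auto
    show "(\<Union>n. {..<real n}) = UNIV"
      using reals_Archimedean2 by auto
    show "emeasure ?M {..<real n} \<noteq> \<infinity>" for n
    proof -
      have "emeasure lborel (radial_cone B \<inter> ball (0 :: real ^ 'd) 1) \<le> emeasure lborel (ball (0 :: real ^ 'd) 1)"
        by (rule emeasure_mono) auto
      also have "\<dots> < \<infinity>"
        by (rule emeasure_lborel_ball_finite)
      finally show ?thesis
        using emeasure_radial_measure_lessThan[OF zero_less_card_finite[where 'a = 'd], of "real n"]
        by (simp add: emeasure_sphere_measure[OF B] ennreal_mult_eq_top_iff ac_simps)
          (metis ennreal_mult_eq_top_iff ennreal_neq_top of_nat_eq_0_iff zero_less_card_finite less_irrefl mult.commute)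
    qed
  qed simp
qed


lemma sigma_finite_radial_measure: "sigma_finite_measure (radial_measure d)"
  unfolding radial_measure_def by (subst sigma_finite_measure.sigma_finite_iff_density_finite[OF sigma_finite_lborel]) auto

lemma finite_sphere_measure: "finite_measure (sphere_measure :: (real ^ 'd) measure)"
proof
  have "emeasure lborel (radial_cone (sphere 0 1) \<inter> ball (0 :: real ^ 'd) 1) \<le> emeasure lborel (ball (0 :: real ^ 'd) 1)"
    by (rule emeasure_mono) auto
  also have "\<dots> < \<infinity>"
    by (rule emeasure_lborel_ball_finite)
  finally show "emeasure (sphere_measure :: (real ^ 'd) measure) (space sphere_measure) \<noteq> \<infinity>"
    using sets.top[of "restrict_space borel (sphere 0 1 :: (real ^ 'd) set)"]
    by (simp add: space_sphere_measure emeasure_sphere_measure ennreal_mult_eq_top_iff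
        space_restrict_space)
qed

text \<open>A product of sigma-finite measures is determined by rectangles. The rectangle
  \<open>A \<times> B\<close> pulls back to the part of the cone over \<open>B\<close> with norm in
  \<open>A\<close>, whose volume \<open>distr_norm_radial_cone\<close> gives as a product.\<close>

theorem polar_coordinates_lborel:
  "radial_measure CARD('d) \<Otimes>\<^sub>M (sphere_measure :: (real ^ 'd) measure)
    = distr (restrict_space lborel (- {0})) (borel \<Otimes>\<^sub>M restrict_space borel (sphere 0 1))
        (\<lambda>y. (norm y, y /\<^sub>R norm y))"
proof (rule pair_measure_eqI)
  show "sigma_finite_measure (radial_measure CARD('d))"
    by (rule sigma_finite_radial_measure)
  show "sigma_finite_measure (sphere_measure :: (real ^ 'd) measure)"
    using finite_sphere_measure by (rule finite_measure.axioms)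
  show "sets (radial_measure CARD('d) \<Otimes>\<^sub>M (sphere_measure :: (real ^ 'd) measure))
    = sets (distr (restrict_space lborel (- {0})) (borel \<Otimes>\<^sub>M restrict_space borel (sphere 0 1))
        (\<lambda>y. (norm y, y /\<^sub>R norm y)))"
    by (simp add: sets_sphere_measure cong: sets_pair_measure_cong)
  fix A :: "real set" and B :: "(real ^ 'd) set"
  assume "A \<in> sets (radial_measure CARD('d))" and "B \<in> sets sphere_measure"
  then have A: "A \<in> sets borel" and B: "B \<in> sets (restrict_space borel (sphere 0 1))"
    by (simp_all add: sets_sphere_measure)
  let ?M = "restrict_space lborel (- {0}) :: (real ^ 'd) measure"
  have [measurable]: "norm \<in> ?M \<rightarrow>\<^sub>M borel" "norm \<in> restrict_space lborel (radial_cone B) \<rightarrow>\<^sub>M borel"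
    by (rule measurable_restrict_space1; simp)+
  have [measurable]: "(\<lambda>y. y /\<^sub>R norm y) \<in> ?M \<rightarrow>\<^sub>M restrict_space borel (sphere 0 1)"
    using measurable_radial_projection[of "- {0 :: real ^ 'd}"]
    by (simp cong: measurable_cong_sets sets_restrict_space_cong)
  have "emeasure (radial_measure CARD('d)) A * emeasure sphere_measure B
      = emeasure (scale_measure (emeasure sphere_measure B) (radial_measure CARD('d))) A"
    by (simp add: mult.commute)
  also have "\<dots> = emeasure (restrict_space lborel (radial_cone B)) (norm -` A \<inter> radial_cone B)"
    using A by (simp add: distr_norm_radial_cone[OF B] emeasure_distr space_restrict_space)
  also have "\<dots> = emeasure lborel (norm -` A \<inter> radial_cone B)"
    using borel_radial_cone[OF B] by (subst emeasure_restrict_space) auto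
  also have "\<dots> = emeasure ?M (norm -` A \<inter> radial_cone B)"
    by (subst emeasure_restrict_space) (auto simp: radial_cone_def)
  also have "norm -` A \<inter> radial_cone B = (\<lambda>y. (norm y, y /\<^sub>R norm y)) -` (A \<times> B) \<inter> space ?M"
    by (auto simp: radial_cone_def space_restrict_space)
  also have "emeasure ?M \<dots> = emeasure (distr ?M (borel \<Otimes>\<^sub>M restrict_space borel (sphere 0 1))
        (\<lambda>y. (norm y, y /\<^sub>R norm y))) (A \<times> B)"
    using A B by (subst emeasure_distr) auto
  finally show "emeasure (radial_measure CARD('d)) A * emeasure sphere_measure B = \<dots>" .
qed

text \<open>Fubini for the product measure above. With \<open>\<bar>r\<bar>\<close> and
  \<open>indicator {0..}\<close> the integrand is one half of an even function, so that the integral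
  over both nappes follows by reflection.\<close>

lemma has_bochner_integral_polar:
  fixes f :: "real ^ 'd \<Rightarrow> real"
  assumes f: "integrable lborel f"
  shows "has_bochner_integral lborel
    (\<lambda>r. indicator {0..} r *\<^sub>R (\<bar>r\<bar> ^ (CARD('d) - 1) * (LINT \<xi>|sphere_measure. f (\<bar>r\<bar> *\<^sub>R \<xi>))))
    (LINT y|lborel. f y)"
proof -
  let ?R = "radial_measure CARD('d)"
  let ?S = "restrict_space borel (sphere 0 1 :: (real ^ 'd) set)"
  let ?M = "restrict_space lborel (- {0}) :: (real ^ 'd) measure"
  interpret S: finite_measure "sphere_measure :: (real ^ 'd) measure"
    by (rule finite_sphere_measure)
  interpret R: sigma_finite_measure ?R
    by (rule sigma_finite_radial_measure)
  interpret pair_sigma_finite ?R "sphere_measure :: (real ^ 'd) measure" ..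
  have [measurable]: "f \<in> borel_measurable borel"
    using borel_measurable_integrable[OF f] by simp
  have [measurable]: "norm \<in> ?M \<rightarrow>\<^sub>M borel"
    by (rule measurable_restrict_space1) simp
  have [measurable]: "(\<lambda>y. y /\<^sub>R norm y) \<in> ?M \<rightarrow>\<^sub>M ?S"
    using measurable_radial_projection[of "- {0 :: real ^ 'd}"]
    by (simp cong: measurable_cong_sets sets_restrict_space_cong)
  have [measurable]: "(\<lambda>\<xi>. \<xi>) \<in> ?S \<rightarrow>\<^sub>M borel" 
    by (rule measurable_restrict_space1) simp
  have F [measurable]: "(\<lambda>(r, \<xi>). f (r *\<^sub>R \<xi>)) \<in> borel_measurable (borel \<Otimes>\<^sub>M ?S)"
    by measurable
  have pm [measurable]: "(\<lambda>y. (norm y, y /\<^sub>R norm y)) \<in> ?M \<rightarrow>\<^sub>M borel \<Otimes>\<^sub>M ?S"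
    by measurable
  have eq: "f (norm y *\<^sub>R (y /\<^sub>R norm y)) = f y" for y
    by (cases "y = 0") auto
  have fM: "integrable ?M f"
    by (subst integrable_restrict_space) (use f in \<open>auto intro: integrable_real_mult_indicator simp: mult.commute\<close>)
  have I: "integrable (?R \<Otimes>\<^sub>M sphere_measure) (\<lambda>(r, \<xi>). f (r *\<^sub>R \<xi>))"
    unfolding polar_coordinates_lborel using fM by (subst integrable_distr_eq[OF pm F]) (simp add: eq del: scaleR_scaleR)
  have "(LINT y|lborel. f y) = (LINT y|?M. f y)"
    using AE_lborel_singleton[of "0 :: real ^ 'd"]
    by (subst integral_restrict_space) (auto intro!: integral_cong_AE elim!: eventually_mono)
  also have "\<dots> = (LINT p|(?R \<Otimes>\<^sub>M sphere_measure). (\<lambda>(r, \<xi>). f (r *\<^sub>R \<xi>)) p)"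
    unfolding polar_coordinates_lborel by (subst integral_distr[OF pm F]) (simp add: eq del: scaleR_scaleR)
  also have "\<dots> = (LINT r|?R. LINT \<xi>|sphere_measure. f (r *\<^sub>R \<xi>))"
    using integral_fst'[OF I] by simp
  finally have "has_bochner_integral ?R (\<lambda>r. LINT \<xi>|sphere_measure. f (r *\<^sub>R \<xi>)) (LINT y|lborel. f y)"
    using integrable_fst'[OF I] by (simp add: has_bochner_integral_iff)
  moreover have meas: "(\<lambda>r. LINT \<xi>|sphere_measure. f (r *\<^sub>R \<xi>)) \<in> borel_measurable borel"
    using integrable_fst'[OF I] by (auto dest: borel_measurable_integrable)
  moreover have nonneg: "AE r :: real in lborel. 0 \<le> indicator {0<..} r * r ^ (CARD('d) - 1)"
    by (intro AE_I2) (auto split: split_indicator)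
  ultimately have *: "has_bochner_integral lborel (\<lambda>r. (indicator {0<..} r * r ^ (CARD('d) - 1)) *\<^sub>R
      (LINT \<xi>|sphere_measure. f (r *\<^sub>R \<xi>))) (LINT y|lborel. f y)"
    using integrable_density[OF _ _ nonneg, of "\<lambda>r. LINT \<xi>|sphere_measure. f (r *\<^sub>R \<xi>)"]
      integral_density[OF _ _ nonneg, of "\<lambda>r. LINT \<xi>|sphere_measure. f (r *\<^sub>R \<xi>)"]
    by (simp add: radial_measure_def has_bochner_integral_iff)
  have [measurable]: "(\<lambda>r. LINT \<xi>|sphere_measure. f (\<bar>r\<bar> *\<^sub>R \<xi>)) \<in> borel_measurable borel"
    by (rule measurable_compose[OF _ meas]) simp
  note meas [measurable]
  \<comment> \<open>Passing from \<open>{0<..}\<close> to \<open>{0..}\<close> and from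
    \<open>r\<close> to \<open>\<bar>r\<bar>\<close> changes the integrand at most at
    \<open>r = 0\<close>.\<close>
  show ?thesis
    using AE_lborel_singleton[of "0 :: real"]
    by (intro has_bochner_integral_cong_AE[THEN iffD1, OF _ _ _ *])
       (auto split: split_indicator elim!: eventually_mono)
qed

text \<open>Each nappe projects onto the whole space and contributes one copy of the integral.
  Agreement is asked only for \<open>t \<noteq> 0\<close>: the slice \<open>t = 0\<close> is null,
  and the weight of the odd case is singular there.\<close>

lemma cone_integral_eq_lborel:
  fixes f :: "real ^ 'd \<Rightarrow> real"
  assumes f: "integrable lborel f"
    and G: "\<And>\<xi> t. norm \<xi> = 1 \<Longrightarrow> t \<noteq> 0 \<Longrightarrow> G (\<bar>t\<bar> *\<^sub>R \<xi>, t) = f (\<bar>t\<bar> *\<^sub>R \<xi>)"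
  shows "cone_integral G = 2 * (LINT y|lborel. f y)"
proof -
  let ?h = "\<lambda>t. \<bar>t\<bar> ^ (CARD('d) - 1) * (LINT \<xi>|sphere_measure. f (\<bar>t\<bar> *\<^sub>R \<xi>))"
  have h: "has_bochner_integral lborel ?h (2 *\<^sub>R (LINT y|lborel. f y))"
    by (rule has_bochner_integral_even_function[OF has_bochner_integral_polar[OF f]]) simp
  have "has_bochner_integral lborel
    (\<lambda>t. \<bar>t\<bar> ^ (CARD('d) - 1) * (LINT \<xi>|sphere_measure. G (\<bar>t\<bar> *\<^sub>R \<xi>, t))) (2 *\<^sub>R (LINT y|lborel. f y))"
    by (rule has_bochner_integral_discrete_difference[THEN iffD1, OF _ _ _ _ h, of "{0}"])
       (auto intro!: Bochner_Integration.integral_cong simp: G space_sphere_measure)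
  then show ?thesis
    unfolding cone_integral_def by (simp add: has_bochner_integral_iff)
qed

subsection \<open>Polynomials of bounded degree\<close>

definition monom_fun :: "('d::finite \<Rightarrow> nat) \<Rightarrow> real ^ 'd \<Rightarrow> real" where
  "monom_fun \<alpha> x = (\<Prod>i\<in>UNIV. (x $ i) ^ \<alpha> i)"

text \<open>The strict degree bound makes \<open>poly_lt 0\<close> the zero polynomial, which is what degree at most
  \<open>n - 1\<close> means for \<open>n = 0\<close>.\<close>

definition poly_lt :: "nat \<Rightarrow> (real ^ 'd \<Rightarrow> real) \<Rightarrow> bool" where
  "poly_lt n F \<longleftrightarrow> (\<exists>c. \<forall>x. F x = (\<Sum>\<alpha> | sum \<alpha> UNIV < n. c \<alpha> * monom_fun \<alpha> x))"

lemma finite_exponents_less: "finite {\<alpha> :: 'd::finite \<Rightarrow> nat. sum \<alpha> UNIV < n}"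
proof (rule finite_subset)
  show "{\<alpha> :: 'd \<Rightarrow> nat. sum \<alpha> UNIV < n} \<subseteq> fst ` exponents_le n"
    by (auto simp: exponents_le_def intro!: image_eqI[of _ _ "(_, 0)"])
  show "finite (fst ` exponents_le n :: ('d \<Rightarrow> nat) set)"
    by (intro finite_imageI finite_exponents_le)
qed

lemma poly_lt_monom: "sum \<alpha> UNIV < n \<Longrightarrow> poly_lt n (\<lambda>x. c * monom_fun \<alpha> x)"
  unfolding poly_lt_def
  by (rule exI[of _ "\<lambda>\<beta>. if \<beta> = \<alpha> then c else 0"])
     (simp add: if_distrib[of "\<lambda>z. z * _"] sum.delta[OF finite_exponents_less] cong: if_cong)

lemma poly_lt_0: "poly_lt n (\<lambda>x. 0)"
  unfolding poly_lt_def by (rule exI[of _ "\<lambda>\<beta>. 0"]) simp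

lemma poly_lt_add:
  assumes "poly_lt n F" "poly_lt n G"
  shows "poly_lt n (\<lambda>x. F x + G x)"
proof -
  obtain c c' where "\<forall>x. F x = (\<Sum>\<alpha> | sum \<alpha> UNIV < n. c \<alpha> * monom_fun \<alpha> x)"
    "\<forall>x. G x = (\<Sum>\<alpha> | sum \<alpha> UNIV < n. c' \<alpha> * monom_fun \<alpha> x)"
    using assms by (auto simp: poly_lt_def)
  then show ?thesis
    unfolding poly_lt_def
    by (intro exI[of _ "\<lambda>\<alpha>. c \<alpha> + c' \<alpha>"]) (simp add: distrib_right sum.distrib)
qed

lemma poly_lt_cmult:
  assumes "poly_lt n F"
  shows "poly_lt n (\<lambda>x. a * F x)"
proof -
  obtain c where "\<forall>x. F x = (\<Sum>\<alpha> | sum \<alpha> UNIV < n. c \<alpha> * monom_fun \<alpha> x)"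
    using assms by (auto simp: poly_lt_def)
  then show ?thesis
    unfolding poly_lt_def
    by (intro exI[of _ "\<lambda>\<alpha>. a * c \<alpha>"]) (simp add: sum_distrib_left mult.assoc)
qed

lemma poly_lt_sum: "(\<And>i. i \<in> I \<Longrightarrow> poly_lt n (F i)) \<Longrightarrow> poly_lt n (\<lambda>x. \<Sum>i\<in>I. F i x)"
  by (induction I rule: infinite_finite_induct) (auto intro: poly_lt_0 poly_lt_add)

text \<open>The finite sum is built up term by term. The premise \<open>poly_lt n G\<close> provides
  the differentiability of the tail that makes \<open>deriv\<close>, and so
  \<open>hermite_op\<close>, additive.\<close>

lemma poly_lt_induct [consumes 1, case_names zero add]:
  assumes "poly_lt n F"
    and zero: "P (\<lambda>x. 0)"
    and add: "\<And>c \<alpha> G. sum \<alpha> UNIV < n \<Longrightarrow> poly_lt n G \<Longrightarrow> P G \<Longrightarrow> P (\<lambda>x. c * monom_fun \<alpha> x + G x)"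
  shows "P F"
proof -
  obtain c where c: "\<forall>x. F x = (\<Sum>\<alpha> | sum \<alpha> UNIV < n. c \<alpha> * monom_fun \<alpha> x)"
    using assms by (auto simp: poly_lt_def)
  have "P (\<lambda>x. \<Sum>\<alpha>\<in>A. c \<alpha> * monom_fun \<alpha> x)" if "finite A" "A \<subseteq> {\<alpha>. sum \<alpha> UNIV < n}" for A
    using that
  proof induction
    case (insert \<alpha> A)
    then show ?case
      by (auto intro!: add poly_lt_sum poly_lt_monom)
  qed (simp add: zero)
  from this[OF finite_exponents_less order_refl] show ?thesis
    using c by (simp add: fun_eq_iff[symmetric])
qed

lemma poly_lt_Suc: "poly_lt n F \<Longrightarrow> poly_lt (Suc n) F"
proof (induction F rule: poly_lt_induct)
  case (add c \<alpha> G)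
  then show ?case
    by (intro poly_lt_add poly_lt_monom) auto
qed (rule poly_lt_0)

lemma monom_fun_mult: "monom_fun \<alpha> x * monom_fun \<beta> x = monom_fun (\<lambda>i. \<alpha> i + \<beta> i) x"
  by (simp add: monom_fun_def power_add prod.distrib)

text \<open>Degrees at most \<open>n - 1\<close> and \<open>m\<close> add up to at most
  \<open>n + m - 1\<close>. The asymmetric bounds avoid truncated subtraction and include
  \<open>n = 0\<close>.\<close>

lemma poly_lt_mult:
  assumes F: "poly_lt n F" and G: "poly_lt (Suc m) G"
  shows "poly_lt (n + m) (\<lambda>x. F x * G x)"
  using F
proof (induction F rule: poly_lt_induct)
  case (add c \<alpha> F)
  from G have "poly_lt (n + m) (\<lambda>x. (c * monom_fun \<alpha> x) * G x)"
  proof (induction G rule: poly_lt_induct)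
    case (add c' \<beta> G)
    have "poly_lt (n + m) (\<lambda>x. (c * c') * monom_fun (\<lambda>i. \<alpha> i + \<beta> i) x)"
      using add(1) \<open>sum \<alpha> UNIV < n\<close> by (intro poly_lt_monom) (simp add: sum.distrib)
    from poly_lt_add[OF this add(3)] show ?case
      by (simp add: distrib_left monom_fun_mult[symmetric] mult_ac)
  qed (simp add: poly_lt_0)
  from poly_lt_add[OF this add(3)] show ?case
    by (simp add: distrib_right)
qed (simp add: poly_lt_0)

lemma monom_fun_upd: "monom_fun (\<alpha>(i := k)) x = (x $ i) ^ k * (\<Prod>j\<in>UNIV - {i}. (x $ j) ^ \<alpha> j)"
proof -
  have "(\<Prod>j\<in>UNIV - {i}. (x $ j) ^ (\<alpha>(i := k)) j) = (\<Prod>j\<in>UNIV - {i}. (x $ j) ^ \<alpha> j)"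
    by (rule prod.cong) auto
  then show ?thesis
    by (simp add: monom_fun_def prod.remove[of UNIV i] del: fun_upd_apply) simp
qed

lemma monom_fun_remove: "monom_fun \<alpha> x = (x $ i) ^ \<alpha> i * (\<Prod>j\<in>UNIV - {i}. (x $ j) ^ \<alpha> j)"
  by (simp add: monom_fun_def prod.remove[of UNIV i])

lemma sum_fun_upd:
  fixes \<alpha> :: "'d::finite \<Rightarrow> nat"
  shows "sum (\<alpha>(i := k)) UNIV + \<alpha> i = sum \<alpha> UNIV + k"
proof -
  have "sum (\<alpha>(i := k)) (UNIV - {i}) = sum \<alpha> (UNIV - {i})"
    by (rule sum.cong) auto
  then show ?thesis
    using sum.remove[of UNIV i \<alpha>] sum.remove[of UNIV i "\<alpha>(i := k)"] by simp
qed

text \<open>The squared norm is a sum of squares of coordinates, a polynomial of degree 2; the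
  induction goes in steps of two, multiplying by it.\<close>

lemma poly_lt_norm_power:
  "even k \<Longrightarrow> poly_lt (Suc k) (\<lambda>x :: real ^ 'd. norm x ^ k)"
proof (induction k rule: induct_nat_012)
  case 0
  show ?case
    using poly_lt_monom[of "\<lambda>_. 0" "Suc 0" 1] by (simp add: monom_fun_def)
next
  case (ge2 k)
  have "poly_lt 3 (\<lambda>x :: real ^ 'd. \<Sum>i\<in>UNIV. 1 * monom_fun ((\<lambda>_. 0)(i := 2)) x)"
    using sum_fun_upd[of "\<lambda>_ :: 'd. 0" _ 2] by (intro poly_lt_sum poly_lt_monom) simp
  then have "poly_lt (Suc 2) (\<lambda>x :: real ^ 'd. norm x ^ 2)"
    by (simp add: monom_fun_upd norm_vec_def L2_set_def sum_nonneg eval_nat_numeral)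
  from poly_lt_mult[OF _ this, of "Suc k" "\<lambda>x. norm x ^ k"] ge2 show ?case
    by (simp add: power_add[symmetric])
qed simp

subsection \<open>Gaussian moments\<close>

definition gauss_moment :: "nat \<Rightarrow> real" where
  "gauss_moment k = (LBINT t. t ^ k * exp (- t\<^sup>2))"

lemma has_bochner_integral_gauss_moment:
  "has_bochner_integral lborel (\<lambda>t::real. exp (- t\<^sup>2) * t ^ (2 * k))
     (sqrt pi * (fact (2 * k) / (2 ^ (2 * k) * fact k)))"
  "has_bochner_integral lborel (\<lambda>t::real. exp (- t\<^sup>2) * t ^ (2 * k + 1)) 0"
  using has_bochner_integral_even_function[OF gaussian_moment_even_pos[of k]]
    has_bochner_integral_odd_function[OF gaussian_moment_odd_pos[of k]] by simp_all

lemma integrable_gauss_moment: "integrable lborel (\<lambda>t::real. t ^ k * exp (- t\<^sup>2))"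
  using has_bochner_integral_gauss_moment[of "k div 2"]
  by (cases "even k") (auto elim!: evenE oddE simp: has_bochner_integral_iff mult.commute)

lemma gauss_moment_even: "gauss_moment (2 * k) = sqrt pi * (fact (2 * k) / (2 ^ (2 * k) * fact k))"
  and gauss_moment_odd: "gauss_moment (2 * k + 1) = 0"
  using has_bochner_integral_gauss_moment[of k]
  by (simp_all add: has_bochner_integral_iff gauss_moment_def mult.commute)

text \<open>The recurrence known from integration by parts, here read off from the closed form of
  the even moments; for odd \<open>k\<close> both sides vanish.\<close>

lemma gauss_moment_Suc_Suc: "2 * gauss_moment (Suc (Suc k)) = real (Suc k) * gauss_moment k"
proof (cases "even k")
  case True
  then obtain j where k: "k = 2 * j" by (elim evenE)
  have eq: "Suc (Suc (2 * j)) = 2 * Suc j"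
    by simp
  have "fact (2 * Suc j) = (2 * real j + 2) * (2 * real j + 1) * fact (2 * j)"
    by (simp add: algebra_simps)
  then show ?thesis
    unfolding k eq gauss_moment_even by (simp add: field_simps del: fact_Suc) (simp add: field_simps)
next
  case False
  then obtain j where k: "k = 2 * j + 1" by (elim oddE)
  show ?thesis
    using gauss_moment_odd[of j] gauss_moment_odd[of "Suc j"] unfolding k by simp
qed

text \<open>One-dimensional symmetry of \<open>f'' - 2 t f'\<close> with respect to
  \<open>exp (- t\<^sup>2)\<close>, tested on \<open>t ^ a\<close> and \<open>t ^ b\<close>. Both
  sides equal \<open>- a b\<close> times the moment of order \<open>a + b - 2\<close>, which is
  symmetric in \<open>a\<close> and \<open>b\<close>.\<close>

lemma gauss_moment_symmetric:
  "real (a * (a - 1)) * gauss_moment (a - 2 + b) - 2 * real a * gauss_moment (a + b)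
    = real (b * (b - 1)) * gauss_moment (a + (b - 2)) - 2 * real b * gauss_moment (a + b)"
proof -
  have *: "real (a * (a - 1)) * gauss_moment (a - 2 + b) - 2 * real a * gauss_moment (a + b)
      = - real (a * b) * gauss_moment (a + b - 2)" for a b
  \<comment> \<open>Outside these cases \<open>a + b \<ge> 2\<close>, so the subtraction in
    \<open>a + b - 2\<close> does not truncate. For \<open>a = 1\<close> the truncated
    \<open>a - 2\<close> has coefficient zero.\<close>
  proof (cases "a = 0 \<or> a + b = 1")
    case True
    then show ?thesis
      using gauss_moment_odd[of 0] by auto
  next
    case False
    then have "2 * gauss_moment (a + b) = (real a + real b - 1) * gauss_moment (a + b - 2)"
      using gauss_moment_Suc_Suc[of "a + b - 2"] by (simp add: Suc_diff_Suc numeral_2_eq_2 of_nat_diff)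
    moreover have "real (a * (a - 1)) * gauss_moment (a - 2 + b) = real a * (real a - 1) * gauss_moment (a + b - 2)"
      using False by (cases "a = 1") (auto simp: of_nat_diff)
    ultimately have "real (a * (a - 1)) * gauss_moment (a - 2 + b) - real a * (2 * gauss_moment (a + b))
        = real a * (real a - 1) * gauss_moment (a + b - 2)
          - real a * ((real a + real b - 1) * gauss_moment (a + b - 2))"
      by (simp only:)
    also have "\<dots> = - real (a * b) * gauss_moment (a + b - 2)"
      by (simp add: algebra_simps)
    finally show ?thesis
      by (simp only: mult_ac)
  qed
  show ?thesis
    using *[of a b] *[of b a] by (simp add: ac_simps)
qed

text \<open>\<open>lborel\<close> is the image of a product of one-dimensional measures indexed by
  \<open>Basis\<close>, over which integrals of products factor. The axis vectors identify
  \<open>Basis\<close> with the coordinate indices.\<close>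

lemma has_bochner_integral_lborel_vec_prod:
  fixes g :: "'d::finite \<Rightarrow> real \<Rightarrow> real"
  assumes g: "\<And>i. integrable lborel (g i)"
  shows "has_bochner_integral lborel (\<lambda>x :: real ^ 'd. \<Prod>i\<in>UNIV. g i (x $ i)) (\<Prod>i\<in>UNIV. LBINT t. g i t)"
proof -
  let ?e = "\<lambda>i :: 'd. axis i (1 :: real)"
  define G where "G b = g (inv ?e b)" for b
  have inj: "inj ?e"
    by (auto simp: inj_on_def axis_eq_axis)
  have B: "Basis = range ?e"
    by (auto simp: Basis_vec_def)
  have G: "G (?e i) = g i" for i
    by (simp add: G_def inv_f_f[OF inj])
  have reindex: "(\<Prod>b\<in>Basis. h b) = (\<Prod>i\<in>UNIV. h (?e i))" for h :: "real ^ 'd \<Rightarrow> real"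
    unfolding B by (rule prod.reindex_cong[OF inj]) auto
  interpret product_sigma_finite "\<lambda>b :: real ^ 'd. interval_measure (\<lambda>x. x)"
    by (simp add: product_sigma_finite_def lborel_eq_real[symmetric] sigma_finite_lborel)
  have Gi: "integrable (interval_measure (\<lambda>x. x)) (G b)" for b
    using g by (simp add: lborel_eq_real[symmetric] G_def)
  have coord: "(\<Sum>b\<in>Basis. f b *\<^sub>R b) $ i = f (?e i)" for f :: "real ^ 'd \<Rightarrow> real" and i
    unfolding cart_eq_inner_axis by (rule inner_sum_left_Basis) (simp add: B)
  have [measurable]: "g i \<in> borel_measurable borel" for i
    using borel_measurable_integrable[OF g[of i]] by simp
  show ?thesis
    unfolding lborel_def[where 'a = "real ^ 'd"]
    by (subst has_bochner_integral_distr)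
       (use product_integral_prod[OF finite_Basis Gi, of "\<lambda>b. b"]
           product_integrable_prod[OF finite_Basis Gi, of "\<lambda>b. b"]
         in \<open>auto simp: has_bochner_integral_iff coord reindex G lborel_eq_real simp del: sum_component\<close>)
qed

lemma has_bochner_integral_monom_fun_gauss:
  "has_bochner_integral lborel (\<lambda>x :: real ^ 'd. monom_fun \<alpha> x * exp (- (norm x)\<^sup>2)) (\<Prod>i\<in>UNIV. gauss_moment (\<alpha> i))"
proof -
  have "exp (- (norm x)\<^sup>2) = (\<Prod>i\<in>UNIV. exp (- (x $ i)\<^sup>2))" for x :: "real ^ 'd"
    by (simp add: norm_vec_def L2_set_def sum_nonneg sum_negf[symmetric] exp_sum)
  then show ?thesis
    using has_bochner_integral_lborel_vec_prod[OF integrable_gauss_moment, of \<alpha>]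
    by (simp add: monom_fun_def gauss_moment_def prod.distrib)
qed

subsection \<open>Second derivatives\<close>

text \<open>\<open>deriv\<close> yields a value even without differentiability, so second
  derivatives are computed through a relation. The first derivative must exist on a neighbourhood in
  order to be differentiated again.\<close>

definition has_deriv2 :: "(real \<Rightarrow> real) \<Rightarrow> real \<Rightarrow> real \<Rightarrow> real \<Rightarrow> bool" where
  "has_deriv2 f a b t \<longleftrightarrow> (\<exists>f'. (\<forall>\<^sub>F s in nhds t. (f has_real_derivative f' s) (at s)) \<and>
     f' t = a \<and> (f' has_real_derivative b) (at t))"

lemma has_deriv2I:
  assumes "\<forall>\<^sub>F s in nhds t. (f has_real_derivative f' s) (at s)"
    and "(f' has_real_derivative b) (at t)" and "f' t = a"
  shows "has_deriv2 f a b t"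
  using assms by (auto simp: has_deriv2_def)

lemma has_deriv2_imp_deriv:
  assumes "has_deriv2 f a b t"
  shows "deriv f t = a" "deriv (deriv f) t = b"
proof -
  obtain f' where f': "\<forall>\<^sub>F s in nhds t. (f has_real_derivative f' s) (at s)"
    "f' t = a" "(f' has_real_derivative b) (at t)"
    using assms by (auto simp: has_deriv2_def)
  have ev: "\<forall>\<^sub>F s in nhds t. deriv f s = f' s"
    using f'(1) by (rule eventually_mono) (rule DERIV_imp_deriv)
  then show "deriv f t = a"
    using f'(2) eventually_nhds_x_imp_x[OF ev] by simp
  show "deriv (deriv f) t = b"
    using deriv_cong_ev[OF ev refl] DERIV_imp_deriv[OF f'(3)] by simp
qed

text \<open>Needed for functions composed with the radial projection, which are rewritten only where
  the argument is nonzero.\<close>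

lemma has_deriv2_cong_ev:
  assumes "has_deriv2 f a b t" and "\<forall>\<^sub>F s in nhds t. f s = g s"
  shows "has_deriv2 g a b t"
proof -
  obtain f' where f': "\<forall>\<^sub>F s in nhds t. (f has_real_derivative f' s) (at s)"
    "f' t = a" "(f' has_real_derivative b) (at t)"
    using assms by (auto simp: has_deriv2_def)
  have "\<forall>\<^sub>F s in nhds t. \<forall>\<^sub>F r in nhds s. f r = g r"
    using assms(2) by (simp add: eventually_eventually)
  with f'(1) have "\<forall>\<^sub>F s in nhds t. (g has_real_derivative f' s) (at s)"
    by eventually_elim (use DERIV_cong_ev in blast)
  with f' show ?thesis
    by (auto simp: has_deriv2_def)
qed

lemma has_deriv2_const: "has_deriv2 (\<lambda>s. c) 0 0 t"
  by (rule has_deriv2I[where f' = "\<lambda>_. 0"]) auto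

lemma has_deriv2_mult:
  assumes "has_deriv2 f a b t" "has_deriv2 g a' b' t"
  shows "has_deriv2 (\<lambda>s. f s * g s) (a * g t + f t * a') (b * g t + 2 * (a * a') + f t * b') t"
proof -
  obtain f' where f': "\<forall>\<^sub>F s in nhds t. (f has_real_derivative f' s) (at s)"
    "f' t = a" "(f' has_real_derivative b) (at t)"
    using assms by (auto simp: has_deriv2_def)
  obtain g' where g': "\<forall>\<^sub>F s in nhds t. (g has_real_derivative g' s) (at s)"
    "g' t = a'" "(g' has_real_derivative b') (at t)"
    using assms by (auto simp: has_deriv2_def)
  show ?thesis
  proof (rule has_deriv2I[where f' = "\<lambda>s. f' s * g s + f s * g' s"])
    show "\<forall>\<^sub>F s in nhds t. ((\<lambda>s. f s * g s) has_real_derivative f' s * g s + f s * g' s) (at s)"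
      using f'(1) g'(1) by eventually_elim (auto intro!: derivative_eq_intros)
    show "((\<lambda>s. f' s * g s + f s * g' s) has_real_derivative b * g t + 2 * (a * a') + f t * b') (at t)"
      using f' g' eventually_nhds_x_imp_x[OF f'(1)] eventually_nhds_x_imp_x[OF g'(1)]
      by (auto intro!: derivative_eq_intros)
  qed (simp add: f' g')
qed

lemma has_deriv2_add:
  assumes "has_deriv2 f a b t" "has_deriv2 g a' b' t"
  shows "has_deriv2 (\<lambda>s. f s + g s) (a + a') (b + b') t"
proof -
  obtain f' where f': "\<forall>\<^sub>F s in nhds t. (f has_real_derivative f' s) (at s)"
    "f' t = a" "(f' has_real_derivative b) (at t)"
    using assms by (auto simp: has_deriv2_def)
  obtain g' where g': "\<forall>\<^sub>F s in nhds t. (g has_real_derivative g' s) (at s)"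
    "g' t = a'" "(g' has_real_derivative b') (at t)"
    using assms by (auto simp: has_deriv2_def)
  show ?thesis
  proof (rule has_deriv2I[where f' = "\<lambda>s. f' s + g' s"])
    show "\<forall>\<^sub>F s in nhds t. ((\<lambda>s. f s + g s) has_real_derivative f' s + g' s) (at s)"
      using f'(1) g'(1) by eventually_elim (auto intro!: derivative_eq_intros)
  qed (use f' g' in \<open>auto intro!: derivative_eq_intros\<close>)
qed

lemma has_deriv2_cmult:
  assumes "has_deriv2 f a b t"
  shows "has_deriv2 (\<lambda>s. c * f s) (c * a) (c * b) t"
  using has_deriv2_mult[OF has_deriv2_const assms] by simp

subsection \<open>The Hermite operator\<close>

text \<open>The truncated exponents \<open>k - 1\<close> and \<open>k - 2\<close> are harmless:
  whenever truncation occurs the coefficient is zero.\<close>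

lemma has_deriv2_power: "has_deriv2 (\<lambda>s. (z + s) ^ k) (real k * z ^ (k - 1)) (real (k * (k - 1)) * z ^ (k - 2)) 0"
  by (rule has_deriv2I[where f' = "\<lambda>s. real k * (z + s) ^ (k - 1)"])
     (auto intro!: always_eventually derivative_eq_intros simp: numeral_2_eq_2)

lemma has_deriv2_monom_fun:
  "has_deriv2 (\<lambda>s. monom_fun \<alpha> (x + s *\<^sub>R axis i 1))
     (real (\<alpha> i) * monom_fun (\<alpha>(i := \<alpha> i - 1)) x)
     (real (\<alpha> i * (\<alpha> i - 1)) * monom_fun (\<alpha>(i := \<alpha> i - 2)) x) 0"
proof -
  have "(\<Prod>j\<in>UNIV - {i}. ((x + s *\<^sub>R axis i 1) $ j) ^ \<alpha> j) = (\<Prod>j\<in>UNIV - {i}. (x $ j) ^ \<alpha> j)" for s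
    by (rule prod.cong) (auto simp: axis_def)
  then have "monom_fun \<alpha> (x + s *\<^sub>R axis i 1) = (\<Prod>j\<in>UNIV - {i}. (x $ j) ^ \<alpha> j) * (x $ i + s) ^ \<alpha> i" for s
    by (simp add: monom_fun_remove[of \<alpha> _ i])
  then show ?thesis
    using has_deriv2_cmult[OF has_deriv2_power, of "\<Prod>j\<in>UNIV - {i}. (x $ j) ^ \<alpha> j" "x $ i" "\<alpha> i"]
    by (simp add: monom_fun_upd mult_ac)
qed

text \<open>The operator \<open>L\<close> of the introduction. A single sum over coordinates
  exhibits it as a sum of one-dimensional Hermite operators, to which the moment identities
  apply.\<close>

definition hermite_op :: "(real ^ 'd \<Rightarrow> real) \<Rightarrow> real ^ 'd \<Rightarrow> real" where
  "hermite_op F x = (\<Sum>i\<in>UNIV. deriv (deriv (\<lambda>s. F (x + s *\<^sub>R axis i 1))) 0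
     - 2 * x $ i * deriv (\<lambda>s. F (x + s *\<^sub>R axis i 1)) 0)"

text \<open>Euler's identity in one coordinate. The common factor \<open>\<alpha> i\<close> absorbs
  the truncated exponent at \<open>\<alpha> i = 0\<close>.\<close>

lemma coord_mult_monom_fun_pred: "real (\<alpha> i) * (x $ i * monom_fun (\<alpha>(i := \<alpha> i - 1)) x) = real (\<alpha> i) * monom_fun \<alpha> x"
  by (cases "\<alpha> i") (simp_all add: monom_fun_upd monom_fun_remove[of \<alpha> _ i] mult.assoc)

lemma hermite_op_monom_fun:
  "hermite_op (monom_fun \<alpha>) x = (\<Sum>i\<in>UNIV. real (\<alpha> i * (\<alpha> i - 1)) * monom_fun (\<alpha>(i := \<alpha> i - 2)) x)
     - 2 * real (sum \<alpha> UNIV) * monom_fun \<alpha> x"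
proof -
  have "hermite_op (monom_fun \<alpha>) x = (\<Sum>i\<in>UNIV. real (\<alpha> i * (\<alpha> i - 1)) * monom_fun (\<alpha>(i := \<alpha> i - 2)) x
      - 2 * (real (\<alpha> i) * (x $ i * monom_fun (\<alpha>(i := \<alpha> i - 1)) x)))"
    by (simp add: hermite_op_def has_deriv2_imp_deriv[OF has_deriv2_monom_fun] mult_ac)
  also have "\<dots> = (\<Sum>i\<in>UNIV. real (\<alpha> i * (\<alpha> i - 1)) * monom_fun (\<alpha>(i := \<alpha> i - 2)) x)
     - 2 * real (sum \<alpha> UNIV) * monom_fun \<alpha> x"
    unfolding coord_mult_monom_fun_pred
    by (simp add: sum_subtractf sum_distrib_left[symmetric] sum_distrib_right[symmetric])
  finally show ?thesis .
qed

lemma poly_lt_has_deriv2: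
  "poly_lt n F \<Longrightarrow> \<exists>a b. \<forall>i. has_deriv2 (\<lambda>s. F (x + s *\<^sub>R axis i 1)) (a i) (b i) 0"
proof (induction F rule: poly_lt_induct)
  case zero
  show ?case
    by (auto intro!: exI[of _ "\<lambda>_. 0"] has_deriv2_const)
next
  case (add c \<alpha> G)
  then obtain a b where "\<forall>i. has_deriv2 (\<lambda>s. G (x + s *\<^sub>R axis i 1)) (a i) (b i) 0"
    by auto
  then show ?case
    using has_deriv2_add[OF has_deriv2_cmult[OF has_deriv2_monom_fun]] by (intro exI allI) fast
qed

lemma hermite_op_add:
  assumes "poly_lt n G"
  shows "hermite_op (\<lambda>x. c * monom_fun \<alpha> x + G x) x = c * hermite_op (monom_fun \<alpha>) x + hermite_op G x"
proof -
  obtain a b where ab: "\<And>i. has_deriv2 (\<lambda>s. G (x + s *\<^sub>R axis i 1)) (a i) (b i) 0"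
    using poly_lt_has_deriv2[OF assms] by blast
  note d = has_deriv2_add[OF has_deriv2_cmult[OF has_deriv2_monom_fun] ab]
  show ?thesis
    by (simp add: hermite_op_def has_deriv2_imp_deriv[OF d] has_deriv2_imp_deriv[OF ab]
        has_deriv2_imp_deriv[OF has_deriv2_monom_fun] sum_distrib_left sum.distrib[symmetric])
       (intro sum.cong refl, simp add: algebra_simps)
qed

lemma hermite_op_0: "hermite_op (\<lambda>x. 0) x = 0"
  by (simp add: hermite_op_def)

lemma sum_fun_upd_diff_less:
  fixes \<alpha> :: "'d::finite \<Rightarrow> nat"
  shows "\<alpha> i * (\<alpha> i - 1) \<noteq> 0 \<Longrightarrow> sum (\<alpha>(i := \<alpha> i - 2)) UNIV < sum \<alpha> UNIV"
  using sum_fun_upd[of \<alpha> i "\<alpha> i - 2"] by auto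

lemma poly_lt_second_derivative:
  assumes "sum \<alpha> UNIV \<le> n"
  shows "poly_lt n (\<lambda>x. \<Sum>i\<in>UNIV. real (\<alpha> i * (\<alpha> i - 1)) * monom_fun (\<alpha>(i := \<alpha> i - 2)) x)"
proof (rule poly_lt_sum)
  fix i
  show "poly_lt n (\<lambda>x. real (\<alpha> i * (\<alpha> i - 1)) * monom_fun (\<alpha>(i := \<alpha> i - 2)) x)"
  proof (cases "\<alpha> i * (\<alpha> i - 1) = 0")
    case False
    then show ?thesis
      using sum_fun_upd_diff_less[of \<alpha> i] False assms by (intro poly_lt_monom) linarith
  qed (auto simp: poly_lt_0)
qed

lemma poly_lt_hermite_op: "poly_lt n F \<Longrightarrow> poly_lt n (hermite_op F)"
proof (induction F rule: poly_lt_induct)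
  case zero
  show ?case
    by (simp add: hermite_op_0 poly_lt_0)
next
  case (add c \<alpha> G)
  have "poly_lt n (\<lambda>x. (\<Sum>i\<in>UNIV. real (\<alpha> i * (\<alpha> i - 1)) * monom_fun (\<alpha>(i := \<alpha> i - 2)) x)
     + (- 2 * real (sum \<alpha> UNIV)) * monom_fun \<alpha> x)"
    using add(1) by (intro poly_lt_add poly_lt_second_derivative poly_lt_monom) auto
  then have "poly_lt n (hermite_op (monom_fun \<alpha>))"
    by (simp add: hermite_op_monom_fun[abs_def] of_nat_sum)
  then show ?case
    using add by (simp add: hermite_op_add[OF add(2), abs_def] poly_lt_add poly_lt_cmult)
qed

text \<open>On a monomial of degree \<open>k\<close> the first-order part is multiplication by
  \<open>- 2 k\<close>, while the second-order part lowers the degree. Adding \<open>2 n\<close>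
  therefore cancels the part of degree \<open>n\<close>.\<close>

lemma poly_lt_hermite_residual:
  "poly_lt (Suc n) F \<Longrightarrow> poly_lt n (\<lambda>x. hermite_op F x + 2 * real n * F x)"
proof (induction F rule: poly_lt_induct)
  case zero
  show ?case
    by (simp add: hermite_op_0 poly_lt_0)
next
  case (add c \<alpha> G)
  have "poly_lt n (\<lambda>x. (\<Sum>i\<in>UNIV. real (\<alpha> i * (\<alpha> i - 1)) * monom_fun (\<alpha>(i := \<alpha> i - 2)) x)
     + 2 * (real n - real (sum \<alpha> UNIV)) * monom_fun \<alpha> x)"
  proof (rule poly_lt_add)
    show "poly_lt n (\<lambda>x. 2 * (real n - real (sum \<alpha> UNIV)) * monom_fun \<alpha> x)"
      using add(1) by (cases "sum \<alpha> UNIV = n") (auto intro: poly_lt_monom simp: poly_lt_0)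
  qed (use add(1) in \<open>intro poly_lt_second_derivative, simp\<close>)
  then have "poly_lt n (\<lambda>x. c * (hermite_op (monom_fun \<alpha>) x + 2 * real n * monom_fun \<alpha> x))"
    by (intro poly_lt_cmult) (simp add: hermite_op_monom_fun algebra_simps)
  from poly_lt_add[OF this add(3)] show ?case
    unfolding hermite_op_add[OF add(2)] by (simp add: algebra_simps)
qed

section \<open>Gaussian inner product, symmetry of the Hermite operator and the eigenvalue
  equation\<close>

definition gauss_integral :: "(real ^ 'd \<Rightarrow> real) \<Rightarrow> real" where
  "gauss_integral F = (LINT x|lborel. F x * exp (- (norm x)\<^sup>2))"

lemma integrable_poly_gauss:
  "poly_lt n F \<Longrightarrow> integrable lborel (\<lambda>x :: real ^ 'd. F x * exp (- (norm x)\<^sup>2))"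
proof (induction F rule: poly_lt_induct)
  case (add c \<alpha> G)
  then show ?case
    using has_bochner_integral_monom_fun_gauss[of \<alpha>]
    by (simp add: distrib_right mult.assoc has_bochner_integral_iff)
qed simp

lemma gauss_integral_monom_fun: "gauss_integral (monom_fun \<alpha>) = (\<Prod>i\<in>UNIV. gauss_moment (\<alpha> i))"
  using has_bochner_integral_monom_fun_gauss[of \<alpha>]
  by (simp add: gauss_integral_def has_bochner_integral_iff)

lemma gauss_integral_add:
  "poly_lt n F \<Longrightarrow> poly_lt m G \<Longrightarrow> gauss_integral (\<lambda>x. F x + G x) = gauss_integral F + gauss_integral G"
  by (simp add: gauss_integral_def distrib_right integrable_poly_gauss)

lemma gauss_integral_cmult: "gauss_integral (\<lambda>x. c * F x) = c * gauss_integral F"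
  by (simp add: gauss_integral_def mult.assoc)

lemma gauss_integral_sum:
  "finite I \<Longrightarrow> (\<And>i. i \<in> I \<Longrightarrow> poly_lt n (F i)) \<Longrightarrow>
    gauss_integral (\<lambda>x. \<Sum>i\<in>I. F i x) = (\<Sum>i\<in>I. gauss_integral (F i))"
  unfolding gauss_integral_def sum_distrib_right
  by (rule Bochner_Integration.integral_sum) (rule integrable_poly_gauss)

text \<open>The \<open>i\<close>-th summand of the operator changes only the \<open>i\<close>-th
  exponent, so the moments of all other coordinates split off as a factor.\<close>

lemma gauss_integral_hermite_op_monom_fun:
  "gauss_integral (\<lambda>x. hermite_op (monom_fun \<alpha>) x * monom_fun \<beta> x)
    = (\<Sum>i\<in>UNIV. (\<Prod>j\<in>UNIV - {i}. gauss_moment (\<alpha> j + \<beta> j)) *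
        (real (\<alpha> i * (\<alpha> i - 1)) * gauss_moment (\<alpha> i - 2 + \<beta> i) - 2 * real (\<alpha> i) * gauss_moment (\<alpha> i + \<beta> i)))"
proof -
  let ?n = "Suc (sum \<alpha> UNIV + sum \<beta> UNIV)"
  have le: "sum (\<alpha>(i := \<alpha> i - 2)) UNIV \<le> sum \<alpha> UNIV" for i
    by (rule sum_mono) auto
  have prod: "gauss_integral (monom_fun (\<lambda>j. (\<alpha>(i := k)) j + \<beta> j))
      = (\<Prod>j\<in>UNIV - {i}. gauss_moment (\<alpha> j + \<beta> j)) * gauss_moment (k + \<beta> i)" for i k
  proof -
    have "(\<Prod>j\<in>UNIV - {i}. gauss_moment ((\<alpha>(i := k)) j + \<beta> j)) = (\<Prod>j\<in>UNIV - {i}. gauss_moment (\<alpha> j + \<beta> j))"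
      by (rule prod.cong) auto
    then show ?thesis
      unfolding gauss_integral_monom_fun by (subst prod.remove[of UNIV i]) (auto simp: mult.commute)
  qed
  \<comment> \<open>The vacuous update \<open>\<alpha>(i := \<alpha> i)\<close> gives both monomials
    the shape treated by \<open>prod\<close>.\<close>
  have "hermite_op (monom_fun \<alpha>) x * monom_fun \<beta> x
      = (\<Sum>i\<in>UNIV. real (\<alpha> i * (\<alpha> i - 1)) * monom_fun (\<lambda>j. (\<alpha>(i := \<alpha> i - 2)) j + \<beta> j) x
          + (- 2 * real (\<alpha> i)) * monom_fun (\<lambda>j. (\<alpha>(i := \<alpha> i)) j + \<beta> j) x)" for x
    unfolding monom_fun_mult[symmetric]
    by (simp add: hermite_op_monom_fun left_diff_distrib sum.distrib sum_distrib_right sum_distrib_left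
        sum_subtractf sum_negf mult.assoc fun_upd_def)
  then have "gauss_integral (\<lambda>x. hermite_op (monom_fun \<alpha>) x * monom_fun \<beta> x)
      = (\<Sum>i\<in>UNIV. gauss_integral (\<lambda>x. real (\<alpha> i * (\<alpha> i - 1)) * monom_fun (\<lambda>j. (\<alpha>(i := \<alpha> i - 2)) j + \<beta> j) x
          + (- 2 * real (\<alpha> i)) * monom_fun (\<lambda>j. (\<alpha>(i := \<alpha> i)) j + \<beta> j) x))"
    using le by (simp only:) (intro gauss_integral_sum[where n = ?n] finite_UNIV poly_lt_add poly_lt_monom;
      simp add: sum.distrib less_Suc_eq_le add_right_mono del: fun_upd_apply)
  also have "\<dots> = (\<Sum>i\<in>UNIV. real (\<alpha> i * (\<alpha> i - 1)) * gauss_integral (monom_fun (\<lambda>j. (\<alpha>(i := \<alpha> i - 2)) j + \<beta> j))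
          + (- 2 * real (\<alpha> i)) * gauss_integral (monom_fun (\<lambda>j. (\<alpha>(i := \<alpha> i)) j + \<beta> j)))"
    using poly_lt_monom[OF lessI]
    by (intro sum.cong refl) (subst gauss_integral_add, assumption, assumption, simp only: gauss_integral_cmult)
  finally show ?thesis
    unfolding prod by (simp add: algebra_simps)
qed

text \<open>Linearity in \<open>F\<close> and in \<open>G\<close> reduces the claim to pairs of
  monomials, where \<open>gauss_moment_symmetric\<close> applies in each coordinate.\<close>

lemma gauss_integral_hermite_op_symmetric:
  assumes F: "poly_lt n F" and G: "poly_lt m G"
  shows "gauss_integral (\<lambda>x. hermite_op F x * G x) = gauss_integral (\<lambda>x. F x * hermite_op G x)"
  using F
proof (induction F rule: poly_lt_induct)
  case zero
  show ?case
    by (simp add: hermite_op_0)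
next
  case (add c \<alpha> F)
  have M: "poly_lt (Suc (sum \<gamma> UNIV)) (monom_fun \<gamma>)" for \<gamma> :: "'d::finite \<Rightarrow> nat"
    using poly_lt_monom[of \<gamma> _ 1] by simp
  have symm: "gauss_integral (\<lambda>x. hermite_op (monom_fun \<alpha>) x * G x)
      = gauss_integral (\<lambda>x. monom_fun \<alpha> x * hermite_op G x)"
    using G
  proof (induction G rule: poly_lt_induct)
    case zero
    show ?case
      by (simp add: hermite_op_0)
  next
    case (add c' \<beta> G)
    have "gauss_integral (\<lambda>x. hermite_op (monom_fun \<alpha>) x * (c' * monom_fun \<beta> x + G x))
        = c' * gauss_integral (\<lambda>x. hermite_op (monom_fun \<alpha>) x * monom_fun \<beta> x)
          + gauss_integral (\<lambda>x. hermite_op (monom_fun \<alpha>) x * G x)"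
      using gauss_integral_add[OF
          poly_lt_cmult[OF poly_lt_mult[OF poly_lt_hermite_op[OF M] M]]
          poly_lt_mult[OF poly_lt_hermite_op[OF M] poly_lt_Suc[OF add(2)]], of c' \<alpha> \<beta> \<alpha>]
      by (simp add: gauss_integral_cmult algebra_simps)
    also have "gauss_integral (\<lambda>x. hermite_op (monom_fun \<alpha>) x * monom_fun \<beta> x)
        = gauss_integral (\<lambda>x. hermite_op (monom_fun \<beta>) x * monom_fun \<alpha> x)"
      unfolding gauss_integral_hermite_op_monom_fun
      by (intro sum.cong refl arg_cong2[where f = "(*)"] trans[OF gauss_moment_symmetric])
         (simp_all add: add.commute)
    also have "c' * \<dots> + gauss_integral (\<lambda>x. hermite_op (monom_fun \<alpha>) x * G x)
        = gauss_integral (\<lambda>x. monom_fun \<alpha> x * hermite_op (\<lambda>x. c' * monom_fun \<beta> x + G x) x)"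
      unfolding add(3) hermite_op_add[OF add(2)]
      using gauss_integral_add[OF
          poly_lt_cmult[OF poly_lt_mult[OF poly_lt_hermite_op[OF M] M]]
          poly_lt_mult[OF M poly_lt_Suc[OF poly_lt_hermite_op[OF add(2)]]], of c' \<beta> \<alpha> \<alpha>]
      by (simp add: gauss_integral_cmult algebra_simps)
    finally show ?case .
  qed
  have "gauss_integral (\<lambda>x. hermite_op (\<lambda>x. c * monom_fun \<alpha> x + F x) x * G x)
      = c * gauss_integral (\<lambda>x. hermite_op (monom_fun \<alpha>) x * G x) + gauss_integral (\<lambda>x. hermite_op F x * G x)"
    using gauss_integral_add[OF
        poly_lt_cmult[OF poly_lt_mult[OF poly_lt_hermite_op[OF M] poly_lt_Suc[OF G]]]
        poly_lt_mult[OF poly_lt_hermite_op[OF add(2)] poly_lt_Suc[OF G]], of c \<alpha>]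
    unfolding hermite_op_add[OF add(2)] by (simp add: gauss_integral_cmult algebra_simps)
  also have "\<dots> = gauss_integral (\<lambda>x. (c * monom_fun \<alpha> x + F x) * hermite_op G x)"
    unfolding symm add(3)
    using gauss_integral_add[OF
        poly_lt_cmult[OF poly_lt_mult[OF M poly_lt_Suc[OF poly_lt_hermite_op[OF G]]]]
        poly_lt_mult[OF add(2) poly_lt_Suc[OF poly_lt_hermite_op[OF G]]], of c \<alpha>]
    by (simp add: gauss_integral_cmult algebra_simps)
  finally show ?case .
qed

lemma continuous_on_poly_lt: "poly_lt n F \<Longrightarrow> continuous_on UNIV F"
  by (induction F rule: poly_lt_induct) (auto simp: monom_fun_def intro!: continuous_intros)

text \<open>A nonnegative integrand with integral zero vanishes almost everywhere. The zero set of
  \<open>F\<close> is closed and of full measure, hence everything.\<close>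

lemma poly_lt_gauss_square_eq_0:
  assumes F: "poly_lt n F" and 0: "gauss_integral (\<lambda>x. F x * F x) = 0"
  shows "F x = 0"
proof -
  from integrable_poly_gauss[OF poly_lt_mult[OF F poly_lt_Suc[OF F]]] 0
  have "AE x in lborel. F x * F x * exp (- (norm x)\<^sup>2) = 0"
    by (subst integral_nonneg_eq_0_iff_AE[symmetric]) (auto simp: gauss_integral_def)
  then have "AE x in lborel. x \<in> {x. F x = 0}"
    by (rule eventually_mono) auto
  moreover have "closed {x. F x = 0}"
    using continuous_on_poly_lt[OF F] by (intro closed_Collect_eq) auto
  ultimately show ?thesis
    using mem_closed_if_AE_lebesgue[of "{x. F x = 0}" x] by (auto intro: AE_completion)
qed

text \<open>For the residual \<open>R\<close>, symmetry gives
  \<open><R, R> = <F, L R> + 2 n <F, R>\<close>. Both terms vanish because \<open>R\<close> and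
  \<open>L R\<close> have degree below \<open>n\<close>.\<close>

theorem hermite_op_eigen:
  assumes F: "poly_lt (Suc n) F"
    and orth: "\<And>G. poly_lt n G \<Longrightarrow> gauss_integral (\<lambda>x. F x * G x) = 0"
  shows "hermite_op F x = - 2 * real n * F x"
proof -
  let ?R = "\<lambda>x. hermite_op F x + 2 * real n * F x"
  have R: "poly_lt n ?R"
    using F by (rule poly_lt_hermite_residual)
  \<comment> \<open>This weaker bound has the form that \<open>poly_lt_mult\<close> asks of its
    second factor.\<close>
  have SR: "poly_lt (Suc n) ?R"
    using F by (intro poly_lt_add poly_lt_hermite_op poly_lt_cmult)
  have "gauss_integral (\<lambda>x. ?R x * ?R x)
      = gauss_integral (\<lambda>x. hermite_op F x * ?R x + 2 * real n * (F x * ?R x))"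
    by (simp add: algebra_simps)
  also have "\<dots> = gauss_integral (\<lambda>x. F x * hermite_op ?R x) + 2 * real n * gauss_integral (\<lambda>x. F x * ?R x)"
    by (subst gauss_integral_add[OF poly_lt_mult[OF poly_lt_hermite_op[OF F] SR]
          poly_lt_cmult[OF poly_lt_mult[OF F SR]]])
       (simp only: gauss_integral_cmult gauss_integral_hermite_op_symmetric[OF F SR])
  also have "\<dots> = 0"
    using orth[OF poly_lt_hermite_op[OF R]] orth[OF R] by simp
  finally have "?R x = 0"
    by (rule poly_lt_gauss_square_eq_0[OF R])
  then show ?thesis
    by simp
qed

subsection \<open>The operators in cone coordinates\<close>

text \<open>Dividing by \<open>t\<close> instead of lowering the exponent covers both signs of
  \<open>t\<close>, and \<open>k = 0\<close>, with one formula.\<close>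

lemma has_real_derivative_abs_power:
  assumes "t \<noteq> 0"
  shows "((\<lambda>s. \<bar>s\<bar> ^ k) has_real_derivative real k * \<bar>t\<bar> ^ k / t) (at t)"
proof (cases "0 < t")
  case True
  have "((\<lambda>s. s ^ k) has_real_derivative real k * \<bar>t\<bar> ^ k / t) (at t)"
    using True by (auto intro!: derivative_eq_intros simp: power_diff_conv_inverse) (cases k; simp)
  then show ?thesis
    by (rule has_field_derivative_transform_within_open[of _ _ _ "{0<..}"]) (use True in auto)
next
  case False
  have "((\<lambda>s. (- s) ^ k) has_real_derivative real k * \<bar>t\<bar> ^ k / t) (at t)"
    using False assms by (auto intro!: derivative_eq_intros) (cases k; simp)
  then show ?thesis
    by (rule has_field_derivative_transform_within_open[of _ _ _ "{..<0}"]) (use False assms in auto)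
qed

lemma has_deriv2_abs_power:
  assumes "t \<noteq> 0"
  shows "has_deriv2 (\<lambda>s. \<bar>s\<bar> ^ k) (real k * \<bar>t\<bar> ^ k / t) (real k * (real k - 1) * \<bar>t\<bar> ^ k / t\<^sup>2) t"
proof (rule has_deriv2I[where f' = "\<lambda>s. real k * \<bar>s\<bar> ^ k / s"])
  have "\<forall>\<^sub>F s in nhds t. s \<noteq> 0"
    using assms by (rule t1_space_nhds)
  then show "\<forall>\<^sub>F s in nhds t. ((\<lambda>s. \<bar>s\<bar> ^ k) has_real_derivative real k * \<bar>s\<bar> ^ k / s) (at s)"
    by (rule eventually_mono) (rule has_real_derivative_abs_power)
  show "((\<lambda>s. real k * \<bar>s\<bar> ^ k / s) has_real_derivative real k * (real k - 1) * \<bar>t\<bar> ^ k / t\<^sup>2) (at t)"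
    using assms
    by (intro DERIV_cong[OF DERIV_divide[OF DERIV_cmult[OF has_real_derivative_abs_power] DERIV_ident]])
       (simp_all add: field_simps power2_eq_square)
qed simp

text \<open>If \<open>z\<close> is the \<open>i\<close>-th coordinate of a unit vector, the base is
  the squared norm of that vector moved by \<open>s\<close> along axis \<open>i\<close>. It stays
  positive near \<open>s = 0\<close>.\<close>

lemma has_deriv2_quadratic_powr:
  "has_deriv2 (\<lambda>s. (1 + 2 * s * z + s\<^sup>2) powr p) (2 * p * z) (4 * p * (p - 1) * z\<^sup>2 + 2 * p) 0"
proof (rule has_deriv2I[where f' = "\<lambda>s. p * (1 + 2 * s * z + s\<^sup>2) powr (p - 1) * (2 * z + 2 * s)"])
  have "((\<lambda>s. 1 + 2 * s * z + s\<^sup>2) \<longlongrightarrow> 1 + 2 * 0 * z + 0\<^sup>2) (nhds 0)"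
    by (intro tendsto_intros filterlim_ident)
  then have "\<forall>\<^sub>F s in nhds 0. 0 < 1 + 2 * s * z + s\<^sup>2"
    by (rule order_tendstoD) simp
  then show "\<forall>\<^sub>F s in nhds 0. ((\<lambda>s. (1 + 2 * s * z + s\<^sup>2) powr p) has_real_derivative
      p * (1 + 2 * s * z + s\<^sup>2) powr (p - 1) * (2 * z + 2 * s)) (at s)"
    by (rule eventually_mono) (auto intro!: derivative_eq_intros simp: powr_diff field_simps)
  show "((\<lambda>s. p * (1 + 2 * s * z + s\<^sup>2) powr (p - 1) * (2 * z + 2 * s)) has_real_derivative
      4 * p * (p - 1) * z\<^sup>2 + 2 * p) (at 0)"
    by (auto intro!: derivative_eq_intros simp: algebra_simps power2_eq_square)
qed simp

lemma norm_add_axis: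
  fixes \<xi> :: "real ^ 'd"
  assumes "norm \<xi> = 1"
  shows "(norm (\<xi> + s *\<^sub>R axis i 1))\<^sup>2 = 1 + 2 * s * \<xi> $ i + s\<^sup>2"
proof -
  have "\<xi> \<bullet> \<xi> = 1" "axis i (1 :: real) \<bullet> axis i 1 = 1"
    using assms by (simp_all add: dot_square_norm)
  then show ?thesis
    unfolding power2_norm_eq_inner
    by (simp add: inner_add_left inner_add_right inner_axis inner_commute power2_eq_square)
qed

lemma eventually_add_axis_neq_0:
  fixes \<xi> :: "real ^ 'd"
  assumes "norm \<xi> = 1"
  shows "\<forall>\<^sub>F s in nhds 0. \<xi> + s *\<^sub>R axis i 1 \<noteq> 0"
proof -
  have "((\<lambda>s. \<xi> + s *\<^sub>R axis i 1) \<longlongrightarrow> \<xi> + 0 *\<^sub>R axis i 1) (nhds 0)"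
    by (intro tendsto_intros filterlim_ident)
  then show ?thesis
    by (rule tendsto_imp_eventually_ne) (use assms in auto)
qed

lemma monom_fun_scaleR: "monom_fun \<alpha> (c *\<^sub>R x) = c ^ sum \<alpha> UNIV * monom_fun \<alpha> x"
  by (simp add: monom_fun_def power_mult_distrib prod.distrib power_sum)

text \<open>By homogeneity the monomial at \<open>y /\<^sub>R norm y\<close> is the monomial at
  \<open>y\<close> times the \<open>- k\<close>-th power of \<open>norm y\<close>, where
  \<open>k\<close> is its degree. The product rule applies, and Euler's identity simplifies the
  mixed term.\<close>

lemma has_deriv2_radial_monom_fun:
  fixes \<xi> :: "real ^ 'd"
  assumes \<xi>: "norm \<xi> = 1"
  shows "has_deriv2 (\<lambda>s. monom_fun \<alpha> ((\<xi> + s *\<^sub>R axis i 1) /\<^sub>R norm (\<xi> + s *\<^sub>R axis i 1)))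
    (real (\<alpha> i) * monom_fun (\<alpha>(i := \<alpha> i - 1)) \<xi> - real (sum \<alpha> UNIV) * \<xi> $ i * monom_fun \<alpha> \<xi>)
    (real (\<alpha> i * (\<alpha> i - 1)) * monom_fun (\<alpha>(i := \<alpha> i - 2)) \<xi>
      - 2 * real (sum \<alpha> UNIV) * (real (\<alpha> i) * monom_fun \<alpha> \<xi>)
      + real (sum \<alpha> UNIV) * ((real (sum \<alpha> UNIV) + 2) * (\<xi> $ i)\<^sup>2 - 1) * monom_fun \<alpha> \<xi>) 0"
proof -
  define k where "k = sum \<alpha> UNIV"
  define y where "y s = \<xi> + s *\<^sub>R axis i 1" for s
  have eq: "\<forall>\<^sub>F s in nhds 0. monom_fun \<alpha> (y s) * (1 + 2 * s * \<xi> $ i + s\<^sup>2) powr (- real k / 2)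
      = monom_fun \<alpha> (y s /\<^sub>R norm (y s))"
    using eventually_add_axis_neq_0[OF \<xi>, of i]
  proof (rule eventually_mono)
    fix s
    assume "\<xi> + s *\<^sub>R axis i 1 \<noteq> 0"
    then have "0 < norm (y s)"
      by (simp add: y_def)
    then have "((norm (y s))\<^sup>2) powr (- real k / 2) = inverse (norm (y s)) ^ k"
      by (simp add: powr_powr powr_minus powr_realpow power_inverse flip: powr_numeral)
    then show "monom_fun \<alpha> (y s) * (1 + 2 * s * \<xi> $ i + s\<^sup>2) powr (- real k / 2)
      = monom_fun \<alpha> (y s /\<^sub>R norm (y s))"
      by (simp add: norm_add_axis[OF \<xi>, of s i, folded y_def] monom_fun_scaleR k_def)
  qed
  have "has_deriv2 (\<lambda>s. monom_fun \<alpha> (y s) * (1 + 2 * s * \<xi> $ i + s\<^sup>2) powr (- real k / 2))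
    (real (\<alpha> i) * monom_fun (\<alpha>(i := \<alpha> i - 1)) \<xi> - real k * \<xi> $ i * monom_fun \<alpha> \<xi>)
    (real (\<alpha> i * (\<alpha> i - 1)) * monom_fun (\<alpha>(i := \<alpha> i - 2)) \<xi>
      - 2 * real k * (real (\<alpha> i) * (\<xi> $ i * monom_fun (\<alpha>(i := \<alpha> i - 1)) \<xi>))
      + real k * ((real k + 2) * (\<xi> $ i)\<^sup>2 - 1) * monom_fun \<alpha> \<xi>) 0"
    \<comment> \<open>At \<open>p = - k / 2\<close> the value
      \<open>4 p (p - 1) z\<^sup>2 + 2 p\<close> becomes
      \<open>k ((k + 2) z\<^sup>2 - 1)\<close>.\<close>
    using has_deriv2_mult[OF has_deriv2_monom_fun has_deriv2_quadratic_powr,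
        of \<alpha> \<xi> i "\<xi> $ i" "- real k / 2"]
    unfolding y_def
    by (rule back_subst[where P = "\<lambda>z. z", OF _ arg_cong2[where f = "\<lambda>a b. has_deriv2 _ a b _"]])
       (simp_all add: field_simps power2_eq_square)
  from has_deriv2_cong_ev[OF this eq] show ?thesis
    unfolding coord_mult_monom_fun_pred by (simp add: y_def k_def)
qed

text \<open>The \<open>t\<close>-derivatives \<open>a\<close>, \<open>b\<close> and the summands \<open>c\<close> of the Laplace-Beltrami operator form a relation, which
  unlike the operators themselves is closed under linear combinations without further assumptions.\<close>

definition cone_derivs :: "(real ^ 'd \<Rightarrow> real) \<Rightarrow> real ^ 'd \<Rightarrow> real \<Rightarrow> real \<Rightarrow> real \<Rightarrow> ('d \<Rightarrow> real) \<Rightarrow> bool" where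
  "cone_derivs F \<xi> t a b c \<longleftrightarrow> has_deriv2 (\<lambda>s. F (\<bar>s\<bar> *\<^sub>R \<xi>)) a b t \<and>
    (\<forall>i. \<exists>c'. has_deriv2 (\<lambda>s. F (\<bar>t\<bar> *\<^sub>R ((\<xi> + s *\<^sub>R axis i 1) /\<^sub>R norm (\<xi> + s *\<^sub>R axis i 1)))) c' (c i) 0) \<and>
    b - 2 * t * a + (real CARD('d) - 1) / t * a + 1 / t\<^sup>2 * sum c UNIV = hermite_op F (\<bar>t\<bar> *\<^sub>R \<xi>)"

text \<open>Along a ray the monomial is a multiple of \<open>\<bar>s\<bar> ^ k\<close>, so the
  second derivative and the term with \<open>d - 1\<close> together contribute
  \<open>k (k + d - 2)\<close>. The spherical part contributes the Euclidean Laplacian minus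
  \<open>k (k + d - 2)\<close>, and these multiples cancel.\<close>

lemma cone_derivs_monom_fun:
  fixes \<xi> :: "real ^ 'd"
  assumes \<xi>: "norm \<xi> = 1" and t: "t \<noteq> 0"
  shows "\<exists>a b c. cone_derivs (monom_fun \<alpha>) \<xi> t a b c"
proof -
  define k where "k = sum \<alpha> UNIV"
  define M where "M = monom_fun \<alpha> \<xi>"
  define D where "D i = real (\<alpha> i * (\<alpha> i - 1)) * monom_fun (\<alpha>(i := \<alpha> i - 2)) \<xi>" for i
  define c where "c i = \<bar>t\<bar> ^ k * (D i - 2 * real k * (real (\<alpha> i) * M)
      + real k * ((real k + 2) * (\<xi> $ i)\<^sup>2 - 1) * M)" for i
  let ?a = "M * (real k * \<bar>t\<bar> ^ k / t)" and ?b = "M * (real k * (real k - 1) * \<bar>t\<bar> ^ k / t\<^sup>2)"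
  have "has_deriv2 (\<lambda>s. monom_fun \<alpha> (\<bar>s\<bar> *\<^sub>R \<xi>)) ?a ?b t"
    using has_deriv2_cmult[OF has_deriv2_abs_power[OF t], of M k]
    by (simp add: monom_fun_scaleR M_def k_def mult.commute)
  moreover have "\<exists>c'. has_deriv2 (\<lambda>s. monom_fun \<alpha> (\<bar>t\<bar> *\<^sub>R ((\<xi> + s *\<^sub>R axis i 1) /\<^sub>R norm (\<xi> + s *\<^sub>R axis i 1)))) c' (c i) 0" for i
    using has_deriv2_cmult[OF has_deriv2_radial_monom_fun[OF \<xi>], of "\<bar>t\<bar> ^ k" \<alpha> i]
    unfolding c_def D_def M_def k_def monom_fun_scaleR[of _ "\<bar>t\<bar>"] by blast
  moreover have "?b - 2 * t * ?a + (real CARD('d) - 1) / t * ?a + 1 / t\<^sup>2 * sum c UNIV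
      = hermite_op (monom_fun \<alpha>) (\<bar>t\<bar> *\<^sub>R \<xi>)"
  proof -
    have sq: "(\<Sum>i\<in>UNIV. (\<xi> $ i)\<^sup>2) = 1"
      using \<xi> by (simp add: norm_vec_def L2_set_def)
    \<comment> \<open>The factor \<open>1\<close> stands for the sum of the squared coordinates of
      \<xi>; \<open>sq[symmetric]\<close> turns it into that sum.\<close>
    have S: "sum c UNIV = \<bar>t\<bar> ^ k * (sum D UNIV - 2 * real k * (real k * M)
        + real k * ((real k + 2) * 1 - real CARD('d)) * M)"
      unfolding sq[symmetric] k_def of_nat_sum
      by (simp add: c_def k_def sum.distrib sum_subtractf sum_distrib_left[symmetric] sum_distrib_right[symmetric])
    \<comment> \<open>A nonzero second derivative is homogeneous of degree \<open>k - 2\<close>,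
      which gives \<open>\<bar>t\<bar> ^ k / t\<^sup>2\<close>; otherwise both sides are
      zero.\<close>
    have "real (\<alpha> i * (\<alpha> i - 1)) * monom_fun (\<alpha>(i := \<alpha> i - 2)) (\<bar>t\<bar> *\<^sub>R \<xi>) = \<bar>t\<bar> ^ k / t\<^sup>2 * D i" for i
    proof (cases "\<alpha> i * (\<alpha> i - 1) = 0")
      case False
      then have "k = sum (\<alpha>(i := \<alpha> i - 2)) UNIV + 2"
        using sum_fun_upd[of \<alpha> i "\<alpha> i - 2"] by (auto simp: k_def)
      then have "\<bar>t\<bar> ^ k / t\<^sup>2 = \<bar>t\<bar> ^ sum (\<alpha>(i := \<alpha> i - 2)) UNIV"
        using t by (simp add: power_add del: fun_upd_apply power_Suc add_2_eq_Suc')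
      then show ?thesis
        by (simp add: D_def monom_fun_scaleR mult_ac del: fun_upd_apply)
    qed (auto simp: D_def)
    then have H: "hermite_op (monom_fun \<alpha>) (\<bar>t\<bar> *\<^sub>R \<xi>) = \<bar>t\<bar> ^ k / t\<^sup>2 * sum D UNIV - 2 * real k * (\<bar>t\<bar> ^ k * M)"
      unfolding hermite_op_monom_fun by (simp add: sum_distrib_left k_def M_def monom_fun_scaleR)
    show ?thesis
      unfolding S H using t by (simp add: field_simps power2_eq_square)
  qed
  ultimately show ?thesis
    unfolding cone_derivs_def by blast
qed

lemma poly_lt_cone_derivs:
  fixes \<xi> :: "real ^ 'd"
  assumes F: "poly_lt n F" and \<xi>: "norm \<xi> = 1" and t: "t \<noteq> 0"
  shows "\<exists>a b c. cone_derivs F \<xi> t a b c"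
  using F
proof (induction F rule: poly_lt_induct)
  case zero
  have "cone_derivs (\<lambda>x. 0) \<xi> t 0 0 (\<lambda>_. 0)"
    by (auto simp: cone_derivs_def hermite_op_0 intro: has_deriv2_const)
  then show ?case
    by blast
next
  case (add k \<alpha> G)
  then obtain a b c where G: "cone_derivs G \<xi> t a b c"
    by blast
  obtain a' b' c' where M: "cone_derivs (monom_fun \<alpha>) \<xi> t a' b' c'"
    using cone_derivs_monom_fun[OF \<xi> t] by blast
  have "cone_derivs (\<lambda>x. k * monom_fun \<alpha> x + G x) \<xi> t (k * a' + a) (k * b' + b) (\<lambda>i. k * c' i + c i)"
    unfolding cone_derivs_def
  proof (intro conjI allI)
    show "has_deriv2 (\<lambda>s. k * monom_fun \<alpha> (\<bar>s\<bar> *\<^sub>R \<xi>) + G (\<bar>s\<bar> *\<^sub>R \<xi>)) (k * a' + a) (k * b' + b) t"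
      using M G by (auto simp: cone_derivs_def intro!: has_deriv2_add has_deriv2_cmult)
    fix i
    let ?y = "\<lambda>s. \<bar>t\<bar> *\<^sub>R ((\<xi> + s *\<^sub>R axis i 1) /\<^sub>R norm (\<xi> + s *\<^sub>R axis i 1))"
    obtain d d' where "has_deriv2 (\<lambda>s. monom_fun \<alpha> (?y s)) d (c' i) 0" "has_deriv2 (\<lambda>s. G (?y s)) d' (c i) 0"
      using M G unfolding cone_derivs_def by blast
    then show "\<exists>d. has_deriv2 (\<lambda>s. k * monom_fun \<alpha> (?y s) + G (?y s)) d (k * c' i + c i) 0"
      by (intro exI) (rule has_deriv2_add[OF has_deriv2_cmult])
  next
    have "k * b' + b - 2 * t * (k * a' + a) + (real CARD('d) - 1) / t * (k * a' + a)
        + 1 / t\<^sup>2 * (\<Sum>i\<in>UNIV. k * c' i + c i)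
      = k * (b' - 2 * t * a' + (real CARD('d) - 1) / t * a' + 1 / t\<^sup>2 * sum c' UNIV)
        + (b - 2 * t * a + (real CARD('d) - 1) / t * a + 1 / t\<^sup>2 * sum c UNIV)"
      by (simp add: sum.distrib sum_distrib_left[symmetric] distrib_left mult_ac right_diff_distrib add_divide_distrib diff_divide_distrib)
    also have "\<dots> = hermite_op (\<lambda>x. k * monom_fun \<alpha> x + G x) (\<bar>t\<bar> *\<^sub>R \<xi>)"
      using M G unfolding cone_derivs_def by (simp only: hermite_op_add[OF add(2)])
    finally show "k * b' + b - 2 * t * (k * a' + a) + (real CARD('d) - 1) / t * (k * a' + a)
        + 1 / t\<^sup>2 * (\<Sum>i\<in>UNIV. k * c' i + c i) = hermite_op (\<lambda>x. k * monom_fun \<alpha> x + G x) (\<bar>t\<bar> *\<^sub>R \<xi>)" .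
  qed
  then show ?case
    by blast
qed


section \<open>Evaluation of the two cone operators on polynomials\<close>

lemma partial_t_eq:
  assumes "has_deriv2 (U \<xi>) a b t"
  shows "partial_t U \<xi> t = a" "partial_t (partial_t U) \<xi> t = b"
proof -
  have "partial_t U \<xi> = deriv (U \<xi>)"
    by (rule ext) (simp add: partial_t_def)
  then show "partial_t U \<xi> t = a" "partial_t (partial_t U) \<xi> t = b"
    using has_deriv2_imp_deriv[OF assms] by (simp_all add: partial_t_def)
qed

text \<open>Since \<open>t\<close> is fixed, \<open>g\<close> is a constant; it is \<open>1\<close>
  in the even case and \<open>t\<close> in the odd case. Near \<open>s = 0\<close> the normalised
  points lie on the sphere, so values of \<open>U\<close> there suffice.\<close>

lemma sphere_laplacian_eq:
  fixes \<xi> :: "real ^ 'd"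
  assumes \<xi>: "norm \<xi> = 1" and U: "\<And>\<eta>. norm \<eta> = 1 \<Longrightarrow> U \<eta> t = g * F (\<bar>t\<bar> *\<^sub>R \<eta>)"
    and F: "cone_derivs F \<xi> t a b c"
  shows "sphere_laplacian U \<xi> t = g * sum c UNIV"
proof -
  have "deriv (deriv (\<lambda>s. U ((\<xi> + s *\<^sub>R axis i 1) /\<^sub>R norm (\<xi> + s *\<^sub>R axis i 1)) t)) 0 = g * c i" for i
  proof -
    let ?y = "\<lambda>s. (\<xi> + s *\<^sub>R axis i 1) /\<^sub>R norm (\<xi> + s *\<^sub>R axis i 1)"
    obtain c' where "has_deriv2 (\<lambda>s. F (\<bar>t\<bar> *\<^sub>R ?y s)) c' (c i) 0"
      using F unfolding cone_derivs_def by blast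
    then have "has_deriv2 (\<lambda>s. g * F (\<bar>t\<bar> *\<^sub>R ?y s)) (g * c') (g * c i) 0"
      by (rule has_deriv2_cmult)
    moreover have "\<forall>\<^sub>F s in nhds 0. g * F (\<bar>t\<bar> *\<^sub>R ?y s) = U (?y s) t"
      using eventually_add_axis_neq_0[OF \<xi>, of i]
    proof (rule eventually_mono)
      fix s
      assume "\<xi> + s *\<^sub>R axis i 1 \<noteq> 0"
      then have "norm (?y s) = 1"
        by (simp del: scaleR_right_distrib)
      then show "g * F (\<bar>t\<bar> *\<^sub>R ?y s) = U (?y s) t"
        by (simp only: U)
    qed
    ultimately show ?thesis
      by (rule has_deriv2_imp_deriv(2)[OF has_deriv2_cong_ev])
  qed
  then show ?thesis
    by (simp add: sphere_laplacian_def laplace_beltrami_def laplacian_def sum_distrib_left)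
qed

lemma cone_op_even_poly_lt:
  fixes \<xi> :: "real ^ 'd"
  assumes F: "poly_lt n F" and \<xi>: "norm \<xi> = 1" and t: "t \<noteq> 0"
    and U: "\<And>\<eta> s. norm \<eta> = 1 \<Longrightarrow> U \<eta> s = F (\<bar>s\<bar> *\<^sub>R \<eta>)"
  shows "cone_op_even U \<xi> t = hermite_op F (\<bar>t\<bar> *\<^sub>R \<xi>)"
proof -
  obtain a b c where abc: "cone_derivs F \<xi> t a b c"
    using poly_lt_cone_derivs[OF F \<xi> t] by blast
  have "U \<xi> = (\<lambda>s. F (\<bar>s\<bar> *\<^sub>R \<xi>))"
    using U[OF \<xi>] by (rule ext)
  then have "has_deriv2 (U \<xi>) a b t"
    using abc by (simp add: cone_derivs_def)
  moreover have "sphere_laplacian U \<xi> t = 1 * sum c UNIV"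
    using \<xi> _ abc by (rule sphere_laplacian_eq) (simp add: U)
  ultimately show ?thesis
    using abc by (simp add: cone_op_even_def partial_t_eq cone_derivs_def)
qed

text \<open>For \<open>t F\<close> the product rule gives derivatives \<open>F + t a\<close> and
  \<open>2 a + t b\<close>. Subtracting \<open>1 / t\<close> times the function leaves
  \<open>(d - 3) a\<close>, and with \<open>2 a\<close> this is the \<open>(d - 1) a\<close> of the
  even operator; \<open>- 2 t F\<close> supplies the shift.\<close>

lemma cone_op_odd_poly_lt:
  fixes \<xi> :: "real ^ 'd"
  assumes F: "poly_lt n F" and \<xi>: "norm \<xi> = 1" and t: "t \<noteq> 0"
    and U: "\<And>\<eta> s. norm \<eta> = 1 \<Longrightarrow> U \<eta> s = s * F (\<bar>s\<bar> *\<^sub>R \<eta>)"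
  shows "cone_op_odd U \<xi> t = t * (hermite_op F (\<bar>t\<bar> *\<^sub>R \<xi>) - 2 * F (\<bar>t\<bar> *\<^sub>R \<xi>))"
proof -
  obtain a b c where abc: "cone_derivs F \<xi> t a b c"
    using poly_lt_cone_derivs[OF F \<xi> t] by blast
  have id: "has_deriv2 (\<lambda>s. s) 1 0 t"
    by (rule has_deriv2I[where f' = "\<lambda>_. 1"]) (auto intro!: always_eventually)
  have "U \<xi> = (\<lambda>s. s * F (\<bar>s\<bar> *\<^sub>R \<xi>))"
    using U[OF \<xi>] by (rule ext)
  then have "has_deriv2 (U \<xi>) (F (\<bar>t\<bar> *\<^sub>R \<xi>) + t * a) (2 * a + t * b) t"
    using has_deriv2_mult[OF id, of "\<lambda>s. F (\<bar>s\<bar> *\<^sub>R \<xi>)" a b] abc by (simp add: cone_derivs_def)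
  moreover have "sphere_laplacian U \<xi> t = t * sum c UNIV"
    using \<xi> _ abc by (rule sphere_laplacian_eq) (simp add: U)
  moreover have "hermite_op F (\<bar>t\<bar> *\<^sub>R \<xi>)
      = b - 2 * t * a + (real CARD('d) - 1) / t * a + 1 / t\<^sup>2 * sum c UNIV"
    using abc by (simp add: cone_derivs_def)
  ultimately show ?thesis
    using t by (simp add: cone_op_odd_def partial_t_eq U[OF \<xi>] field_simps power2_eq_square)
qed

subsection \<open>Polynomials on the double cone\<close>

text \<open>Used with \<open>j = 0\<close> and \<open>j = 1\<close> to turn polynomials in
  \<open>x\<close> into even and odd test functions.\<close>

lemma poly_fun_le_mult_power:
  fixes F :: "real ^ 'd \<Rightarrow> real"
  assumes "poly_lt n F" "n \<le> Suc m"
  shows "poly_fun_le (m + j) (\<lambda>(x, t). F x * t ^ j)"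
proof -
  obtain c where c: "\<And>x. F x = (\<Sum>\<alpha> | sum \<alpha> UNIV < n. c \<alpha> * monom_fun \<alpha> x)"
    using assms by (auto simp: poly_lt_def)
  let ?E = "{\<alpha> :: 'd \<Rightarrow> nat. sum \<alpha> UNIV < n}"
  have "(\<Sum>(\<alpha>, k)\<in>exponents_le (m + j). (if \<alpha> \<in> ?E \<and> k = j then c \<alpha> else 0) * ((\<Prod>i\<in>UNIV. (x $ i) ^ \<alpha> i) * t ^ k))
      = F x * t ^ j" for x t
  proof -
    have "(\<Sum>(\<alpha>, k)\<in>exponents_le (m + j). (if \<alpha> \<in> ?E \<and> k = j then c \<alpha> else 0) * ((\<Prod>i\<in>UNIV. (x $ i) ^ \<alpha> i) * t ^ k))
        = (\<Sum>(\<alpha>, k)\<in>(\<lambda>\<alpha>. (\<alpha>, j)) ` ?E. (if \<alpha> \<in> ?E \<and> k = j then c \<alpha> else 0) * ((\<Prod>i\<in>UNIV. (x $ i) ^ \<alpha> i) * t ^ k))"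
      using assms(2) by (intro sum.mono_neutral_right finite_exponents_le) (auto simp: exponents_le_def image_iff)
    also have "\<dots> = (\<Sum>\<alpha>\<in>?E. c \<alpha> * (monom_fun \<alpha> x * t ^ j))"
      by (subst sum.reindex) (auto simp: inj_on_def monom_fun_def)
    finally show ?thesis
      by (simp add: c sum_distrib_right mult.assoc)
  qed
  then show ?thesis
    unfolding poly_fun_le_def by (intro exI[of _ "\<lambda>\<alpha> k. if \<alpha> \<in> ?E \<and> k = j then c \<alpha> else 0"]) simp
qed

lemma poly_lt_parity_part:
  fixes p :: "(real ^ 'd) \<times> real \<Rightarrow> real"
  assumes "poly_fun_le n p"
  shows "\<exists>F. poly_lt (Suc n) F \<and> (\<forall>(x, t)\<in>double_cone. (p (x, t) + p (x, - t)) / 2 = F x)"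
    and "\<exists>F. poly_lt n F \<and> (\<forall>(x, t)\<in>double_cone. (p (x, t) - p (x, - t)) / 2 = t * F x)"
proof -
  let ?E = "exponents_le n :: (('d \<Rightarrow> nat) \<times> nat) set"
  obtain c where c: "\<And>x t. p (x, t) = (\<Sum>(\<alpha>, k)\<in>?E. c \<alpha> k * (monom_fun \<alpha> x * t ^ k))"
    using assms by (auto simp: poly_fun_le_def monom_fun_def)
  txt \<open>On the cone \<open>t\<close> to an even power is the same power of the norm of \<open>x\<close>, a polynomial in
    \<open>x\<close>; \<open>j = 0\<close> collects the even powers of \<open>t\<close>, and \<open>j = 1\<close> the odd powers divided by \<open>t\<close>.\<close>
  define H where "H j \<alpha> k x = (if even (k + j) \<and> j \<le> k then c \<alpha> k * (monom_fun \<alpha> x * norm x ^ (k - j)) else 0)"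
    for j \<alpha> k and x :: "real ^ 'd"
  have H: "poly_lt (Suc n - j) (\<lambda>x. \<Sum>(\<alpha>, k)\<in>?E. H j \<alpha> k x)" if "j \<le> 1" for j
  proof (rule poly_lt_sum, clarify)
    fix \<alpha> :: "'d \<Rightarrow> nat" and k
    assume "(\<alpha>, k) \<in> ?E"
    then have le: "sum \<alpha> UNIV + k \<le> n"
      by (simp add: exponents_le_def)
    show "poly_lt (Suc n - j) (H j \<alpha> k)"
    proof (cases "even (k + j) \<and> j \<le> k")
      case True
      \<comment> \<open>The monomial has degree at most \<open>n - k\<close> and the norm power
        \<open>k - j\<close>; the strict bounds add up to \<open>Suc n - j\<close>.\<close>
      then have "poly_lt (Suc n - k + (k - j)) (\<lambda>x. (c \<alpha> k * monom_fun \<alpha> x) * norm x ^ (k - j))"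
        using le by (intro poly_lt_mult poly_lt_monom poly_lt_norm_power) auto
      then show ?thesis
        using True le by (simp add: H_def[abs_def] mult.assoc)
    next
      case False
      then have "H j \<alpha> k = (\<lambda>x. 0)"
        by (auto simp: H_def fun_eq_iff)
      then show ?thesis
        by (simp add: poly_lt_0)
    qed
  qed
  have pow: "norm x ^ k = t ^ k" if "norm x = \<bar>t\<bar>" "even k" for x :: "real ^ 'd" and t :: real and k
    using that by (simp add: power_even_abs)
  have "(p (x, t) + p (x, - t)) / 2 = (\<Sum>(\<alpha>, k)\<in>?E. H 0 \<alpha> k x)" if "(x, t) \<in> double_cone" for x t
    unfolding c sum.distrib[symmetric] sum_divide_distrib
    using that by (intro sum.cong refl) (auto simp: double_cone_def H_def pow power_even_abs field_simps)
  with H[of 0] show "\<exists>F. poly_lt (Suc n) F \<and> (\<forall>(x, t)\<in>double_cone. (p (x, t) + p (x, - t)) / 2 = F x)"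
    by auto
  have "(p (x, t) - p (x, - t)) / 2 = t * (\<Sum>(\<alpha>, k)\<in>?E. H 1 \<alpha> k x)" if xt: "(x, t) \<in> double_cone" for x t
  proof -
    have "(c \<alpha> k * (monom_fun \<alpha> x * t ^ k) - c \<alpha> k * (monom_fun \<alpha> x * (- t) ^ k)) / 2 = t * H 1 \<alpha> k x"
      for \<alpha> k
    proof (cases "even k")
      case True
      then show ?thesis
        by (simp add: H_def)
    next
      case False
      then obtain b where k: "k = 2 * b + 1"
        by (elim oddE)
      have "norm x ^ (2 * b) = t ^ (2 * b)"
        using xt by (intro pow) (auto simp: double_cone_def)
      then show ?thesis
        by (simp add: H_def k mult_ac)
    qed
    then show ?thesis
      unfolding c sum_subtractf[symmetric] sum_divide_distrib sum_distrib_left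
      by (intro sum.cong refl) (simp only: split_beta)
  qed
  with H[of 1] show "\<exists>F. poly_lt n F \<and> (\<forall>(x, t)\<in>double_cone. (p (x, t) - p (x, - t)) / 2 = t * F x)"
    by auto
qed

lemma double_cone_coords: "norm \<xi> = 1 \<Longrightarrow> (\<bar>t\<bar> *\<^sub>R \<xi>, t) \<in> double_cone"
  by (simp add: double_cone_def)

lemma double_cone_uminus: "(x, t) \<in> double_cone \<Longrightarrow> (x, - t) \<in> double_cone"
  by (simp add: double_cone_def)

text \<open>Only the restriction \<open>u\<close> is assumed even, not \<open>p\<close>. As the cone
  is invariant under reflection in \<open>t\<close>, \<open>u\<close> agrees there with the even
  part of \<open>p\<close>.\<close>

lemma cone_even_poly:
  assumes p: "poly_fun_le n p" and u: "u = restrict p double_cone" "cone_even u"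
  obtains F where "poly_lt (Suc n) F" "\<And>x t. (x, t) \<in> double_cone \<Longrightarrow> u (x, t) = F x"
proof -
  obtain F where F: "poly_lt (Suc n) F" "\<And>x t. (x, t) \<in> double_cone \<Longrightarrow> (p (x, t) + p (x, - t)) / 2 = F x"
    using poly_lt_parity_part(1)[OF p] by blast
  have "u (x, t) = F x" if "(x, t) \<in> double_cone" for x t
    using F(2)[OF that] that double_cone_uminus[OF that] u by (auto simp: cone_even_def)
  with F(1) show ?thesis
    by (rule that)
qed

lemma cone_odd_poly:
  assumes p: "poly_fun_le n p" and u: "u = restrict p double_cone" "cone_odd u"
  obtains F where "poly_lt n F" "\<And>x t. (x, t) \<in> double_cone \<Longrightarrow> u (x, t) = t * F x"
proof -
  obtain F where F: "poly_lt n F" "\<And>x t. (x, t) \<in> double_cone \<Longrightarrow> (p (x, t) - p (x, - t)) / 2 = t * F x"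
    using poly_lt_parity_part(2)[OF p] by blast
  have "u (x, t) = t * F x" if "(x, t) \<in> double_cone" for x t
    using F(2)[OF that] that double_cone_uminus[OF that] u by (auto simp: cone_odd_def)
  with F(1) show ?thesis
    by (rule that)
qed

text \<open>The weight enters only through the product, so both cases are covered: in the odd one
  the two factors \<open>t\<close> cancel the negative power of
  \<open>\<bar>t\<bar>\<close>.\<close>

lemma cone_inner_eq_gauss_integral:
  fixes F G :: "real ^ 'd \<Rightarrow> real"
  assumes F: "poly_lt n F" and G: "poly_lt m G"
    and fg: "\<And>x t. (x, t) \<in> double_cone \<Longrightarrow> t \<noteq> 0 \<Longrightarrow> f (x, t) * g (x, t) * w t = F x * G x * exp (- t\<^sup>2)"
  shows "cone_inner w f g = 2 * gauss_integral (\<lambda>x. F x * G x)"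
  unfolding cone_inner_def gauss_integral_def
proof (rule cone_integral_eq_lborel)
  show "integrable lborel (\<lambda>x. F x * G x * exp (- (norm x)\<^sup>2))"
    by (rule integrable_poly_gauss[OF poly_lt_mult[OF F poly_lt_Suc[OF G]]])
qed (simp add: fg double_cone_coords)

section \<open>The differential equations on the two orthogonal spaces\<close>

lemma cone_op_even_cone_VE:
  fixes u :: "(real ^ 'd) \<times> real \<Rightarrow> real"
  assumes u: "u \<in> cone_VE n (\<lambda>t. exp (- t\<^sup>2))" and \<xi>: "norm \<xi> = 1" and t: "t \<noteq> 0"
  shows "cone_op_even (cone_coords u) \<xi> t = - 2 * real n * cone_coords u \<xi> t"
proof -
  obtain p where p: "poly_fun_le n p" "u = restrict p double_cone" "cone_even u"
    and orth: "\<And>m q. m < n \<Longrightarrow> poly_fun_le m q \<Longrightarrow> cone_even q \<Longrightarrow> cone_inner (\<lambda>t. exp (- t\<^sup>2)) u q = 0"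
    using u by (auto simp: cone_VE_def cone_orth_space_def)
  obtain F where F: "poly_lt (Suc n) F" and uF: "\<And>x t. (x, t) \<in> double_cone \<Longrightarrow> u (x, t) = F x"
    by (rule cone_even_poly[OF p]) (rule that, assumption, blast)
  have "gauss_integral (\<lambda>x. F x * G x) = 0" if G: "poly_lt n G" for G
  proof (cases n)
    case 0
    then show ?thesis
      using G by (simp add: poly_lt_def gauss_integral_def)
  next
    case (Suc m)
    have "cone_inner (\<lambda>t. exp (- t\<^sup>2)) u (\<lambda>(x, t). G x * t ^ 0) = 2 * gauss_integral (\<lambda>x. F x * G x)"
      using F G by (rule cone_inner_eq_gauss_integral) (simp add: uF)
    \<comment> \<open>\<open>G\<close> is constant in \<open>t\<close>, hence even, and has degree
      at most \<open>m < n\<close>.\<close>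
    moreover have "cone_inner (\<lambda>t. exp (- t\<^sup>2)) u (\<lambda>(x, t). G x * t ^ 0) = 0"
      using Suc poly_fun_le_mult_power[OF G, of m 0] by (intro orth[of m]) (auto simp: cone_even_def)
    ultimately show ?thesis
      by simp
  qed
  then have "hermite_op F x = - 2 * real n * F x" for x
    by (rule hermite_op_eigen[OF F])
  moreover have coords: "cone_coords u \<eta> s = F (\<bar>s\<bar> *\<^sub>R \<eta>)" if "norm \<eta> = 1" for \<eta> s
    using that by (simp add: cone_coords_def uF double_cone_coords)
  ultimately show ?thesis
    using cone_op_even_poly_lt[OF F \<xi> t coords] \<xi> by simp
qed

lemma cone_op_odd_cone_VO:
  fixes u :: "(real ^ 'd) \<times> real \<Rightarrow> real"
  assumes u: "u \<in> cone_VO n (\<lambda>t. \<bar>t\<bar> powi (- 2) * exp (- t\<^sup>2))" and \<xi>: "norm \<xi> = 1" and t: "t \<noteq> 0"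
  shows "cone_op_odd (cone_coords u) \<xi> t = - 2 * real n * cone_coords u \<xi> t"
proof -
  let ?w = "\<lambda>t :: real. \<bar>t\<bar> powi (- 2) * exp (- t\<^sup>2)"
  obtain p where p: "poly_fun_le n p" "u = restrict p double_cone" "cone_odd u"
    and orth: "\<And>m q. m < n \<Longrightarrow> poly_fun_le m q \<Longrightarrow> cone_odd q \<Longrightarrow> cone_inner ?w u q = 0"
    using u by (auto simp: cone_VO_def cone_orth_space_def)
  obtain F where F: "poly_lt n F" and uF: "\<And>x t. (x, t) \<in> double_cone \<Longrightarrow> u (x, t) = t * F x"
    by (rule cone_odd_poly[OF p]) (rule that, assumption, blast)
  \<comment> \<open>For \<open>n = Suc m\<close> the factor \<open>F\<close> has degree at most
    \<open>m\<close> and eigenvalue \<open>- 2 m\<close>; the shift by \<open>- 2\<close> restores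
    \<open>- 2 n\<close>. For \<open>n = 0\<close> the strict degree bound forces
    \<open>F = 0\<close>.\<close>
  have eigen: "hermite_op F x - 2 * F x = - 2 * real n * F x" for x
  proof (cases n)
    case 0
    then have "F = (\<lambda>x. 0)"
      using F by (auto simp: poly_lt_def)
    then show ?thesis
      by (simp add: hermite_op_0)
  next
    case (Suc m)
    \<comment> \<open>For \<open>G\<close> of degree below \<open>m\<close>, \<open>t G\<close> has
      degree at most \<open>m < n\<close> and is an admissible odd test function. For
      \<open>m = 0\<close> only \<open>G = 0\<close> occurs.\<close>
    have "gauss_integral (\<lambda>x. F x * G x) = 0" if G: "poly_lt m G" for G
    proof (cases m)
      case 0
      then show ?thesis
        using G by (simp add: poly_lt_def gauss_integral_def)
    next
      case (Suc l)
      have "cone_inner ?w u (\<lambda>(x, t). G x * t ^ 1) = 2 * gauss_integral (\<lambda>x. F x * G x)"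
        using F G by (rule cone_inner_eq_gauss_integral)
          (simp add: uF power_int_minus field_simps power2_eq_square)
      moreover have "cone_inner ?w u (\<lambda>(x, t). G x * t ^ 1) = 0"
        using Suc \<open>n = Suc m\<close> poly_fun_le_mult_power[OF G, of l 1] by (intro orth[of m]) (auto simp: cone_odd_def)
      ultimately show ?thesis
        by simp
    qed
    then have "hermite_op F x = - 2 * real m * F x"
      using F Suc by (intro hermite_op_eigen) auto
    then show ?thesis
      by (simp add: Suc algebra_simps)
  qed
  have coords: "cone_coords u \<eta> s = s * F (\<bar>s\<bar> *\<^sub>R \<eta>)" if "norm \<eta> = 1" for \<eta> s
    using that by (simp add: cone_coords_def uF double_cone_coords)
  have "cone_op_odd (cone_coords u) \<xi> t = t * (hermite_op F (\<bar>t\<bar> *\<^sub>R \<xi>) - 2 * F (\<bar>t\<bar> *\<^sub>R \<xi>))"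
    by (rule cone_op_odd_poly_lt[OF F \<xi> t coords])
  then show ?thesis
    unfolding eigen coords[OF \<xi>] by (simp add: mult_ac)
qed

theorem theorem7p3:
  assumes "CARD('d::finite) \<ge> 2"
  shows
    "(\<forall>n. \<forall>u \<in> (cone_VE n (\<lambda>t. exp (- (t\<^sup>2))) :: ((real ^ 'd) \<times> real \<Rightarrow> real) set).
        \<forall>\<xi> \<in> sphere 0 1. \<forall>t. t \<noteq> 0 \<longrightarrow>
          cone_op_even (cone_coords u) \<xi> t = - 2 * real n * cone_coords u \<xi> t) \<and>
     (\<forall>n. \<forall>u \<in> (cone_VO n (\<lambda>t. \<bar>t\<bar> powi (- 2) * exp (- (t\<^sup>2))) :: ((real ^ 'd) \<times> real \<Rightarrow> real) set).
        \<forall>\<xi> \<in> sphere 0 1. \<forall>t. t \<noteq> 0 \<longrightarrow>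
          cone_op_odd (cone_coords u) \<xi> t = - 2 * real n * cone_coords u \<xi> t)"
proof (intro conjI allI ballI impI)
  fix n and t :: real and \<xi> :: "real ^ 'd" and u :: "(real ^ 'd) \<times> real \<Rightarrow> real"
  assume "u \<in> cone_VE n (\<lambda>t. exp (- (t\<^sup>2)))" "\<xi> \<in> sphere 0 1" "t \<noteq> 0"
  then show "cone_op_even (cone_coords u) \<xi> t = - 2 * real n * cone_coords u \<xi> t"
    by (intro cone_op_even_cone_VE) auto
next
  fix n and t :: real and \<xi> :: "real ^ 'd" and u :: "(real ^ 'd) \<times> real \<Rightarrow> real"
  assume "u \<in> cone_VO n (\<lambda>t. \<bar>t\<bar> powi (- 2) * exp (- (t\<^sup>2)))" "\<xi> \<in> sphere 0 1" "t \<noteq> 0"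
  then show "cone_op_odd (cone_coords u) \<xi> t = - 2 * real n * cone_coords u \<xi> t"
    by (intro cone_op_odd_cone_VO) auto
qed

end
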